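(* In the non-Bayesian learning model described in the context, suppose that there is an agent $j_0\in[n]$ with $\mu_{j_0,0}(\theta^* )>0$, and that $\{A(t)\}_{t=0}^\infty$ is deterministic and uniformly strongly connected. Then all the agents' beliefs converge to a consensus $\mathbb P^*$-a.s., i.e., for each $\theta\in\Theta$ there exists a random variable $C_\theta\in[0,1]$ such that $\lim_{t\to\infty}\mu_t(\theta)=C_\theta\mathbf 1$ a.s.
   Context: Notation: $\mathbb N=\{1,2,\dots\}$, $\mathbb N_0=\mathbb N\cup\{0\}$, $[n]=\{1,\dots,n\}$, $\mathbf 1$ is the all-ones vector. A matrix is stochastic if it is non-negative with all row sums $1$; a stochastic chain is a sequence of stochastic matrices. Model. There are $n$ agents and a finite set $\Theta$ of states, with true state $\theta^*\in\Theta$. Agent $i$ has a finite signal space $S_i$; $S:=S_1\times\cdots\times S_n$. For each $\theta\in\Theta$, $l(\cdot|\theta)$ is a probability measure on $S$ with $i$-th marginal $l_i(\cdot|\theta)$, and $l_i(s|\theta)>0$ for all $i\in[n]$, $s\in S_i$, $\theta\in\Theta$. On a probability space with measure $\mathbb P^*$ there are signals $\omega_t=(\omega_{1,t},\dots,\omega_{n,t})\in S$, $t\in\mathbb N$, i.i.d. with law $l(\cdot|\theta^* )$. Let $A(t)=(a_{ij}(t))$, $t\in\mathbb N_0$, be $n\times n$ stochastic matrices. Each agent $i$ has a given (non-random) prior probability measure $\mu_{i,0}$ on $\Theta$, and beliefs are updated by $$\mu_{i,t+1}(\theta)=a_{ii}(t)\,\frac{l_i(\omega_{i,t+1}|\theta)\mu_{i,t}(\theta)}{\sum_{\theta'\in\Theta}l_i(\omega_{i,t+1}|\theta')\mu_{i,t}(\theta')}+\sum_{j\ne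 i}a_{ij}(t)\mu_{j,t}(\theta),\qquad \theta\in\Theta,\ t\in\mathbb N_0 .$$ $\mu_t(\theta):=[\mu_{1,t}(\theta),\dots,\mu_{n,t}(\theta)]^T$. Uniform strong connectivity. A deterministic stochastic chain $\{A(t)\}_{t=0}^\infty$ is uniformly strongly connected if: (1) there is $\delta>0$ such that for all $i,j\in[n]$, $t\in\mathbb N_0$, either $a_{ij}(t)\ge\delta$ or $a_{ij}(t)=0$; (2) $a_{ii}(t)>0$ for all $i\in[n]$, $t\in\mathbb N_0$; (3) there is $B\in\mathbb N$ such that, with $E(t):=\{(i,j)\in[n]^2:a_{ji}(t)>0\}$, the directed graph $\big([n],\bigcup_{q=kB}^{(k+1)B-1}E(q)\big)$ is strongly connected for every $k\in\mathbb N_0$. *)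

theory Defs
  imports "HOL-Probability.Probability" "Graph_Theory.Digraph_Component"
begin

definition stochastic_matrix :: "real^'n^'n \<Rightarrow> bool" where
  "stochastic_matrix A \<longleftrightarrow> (\<forall>i j. 0 \<le> A $ i $ j) \<and> (\<forall>i. (\<Sum>j\<in>UNIV. A $ i $ j) = 1)"

text \<open>An edge points from the influencing agent to the influenced one, hence the
  transposed indices.\<close>

definition influence_edges :: "real^'n^'n \<Rightarrow> ('n \<times> 'n) set" where
  "influence_edges A = {(i, j). A $ j $ i > 0}"

definition uniformly_strongly_connected :: "(nat \<Rightarrow> real^'n^'n) \<Rightarrow> bool" where
  "uniformly_strongly_connected A \<longleftrightarrow>
     (\<exists>\<delta>>0. \<forall>i j t. A t $ i $ j \<ge> \<delta> \<or> A t $ i $ j = 0) \<and>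
     (\<forall>i t. A t $ i $ i > 0) \<and>
     (\<exists>B\<ge>1. \<forall>k. strongly_connected
        (with_proj \<lparr> pverts = UNIV,
                     parcs = (\<Union>q\<in>{k * B..<(k + 1) * B}. influence_edges (A q)) \<rparr>))"

definition marginal_likelihood ::
    "('state \<Rightarrow> ('n \<Rightarrow> 'sig) pmf) \<Rightarrow> 'n \<Rightarrow> 'sig \<Rightarrow> 'state \<Rightarrow> real" where
  "marginal_likelihood l i s \<theta> = pmf (map_pmf (\<lambda>x. x i) (l \<theta>)) s"

text \<open>The beliefs along one fixed signal path \<open>w\<close>; the value of \<open>w\<close> at time \<open>0\<close> is never used.\<close>

primrec belief ::
    "(nat \<Rightarrow> real^'n^'n) \<Rightarrow> ('state::finite \<Rightarrow> ('n \<Rightarrow> 'sig) pmf) \<Rightarrow> ('n \<Rightarrow> 'state pmf) \<Rightarrow>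
     (nat \<Rightarrow> 'n \<Rightarrow> 'sig) \<Rightarrow> nat \<Rightarrow> 'state \<Rightarrow> real^'n" where
  "belief A l \<mu>0 w 0 \<theta> = (\<chi> i. pmf (\<mu>0 i) \<theta>)"
| "belief A l \<mu>0 w (Suc t) \<theta> =
     (\<chi> i. A t $ i $ i *
             (marginal_likelihood l i (w (Suc t) i) \<theta> * belief A l \<mu>0 w t \<theta> $ i /
              (\<Sum>\<theta>'\<in>UNIV. marginal_likelihood l i (w (Suc t) i) \<theta>' * belief A l \<mu>0 w t \<theta>' $ i))
           + (\<Sum>j\<in>UNIV - {i}. A t $ i $ j * belief A l \<mu>0 w t \<theta> $ j))"

end

theory Submission
  imports Defs
begin

text \<open>Uniform strong connectivity yields an absolute probability sequence \<open>\<pi>\<close>, i.e. probability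
  vectors with \<open>\<pi>(t) = \<pi>(t+1) A(t)\<close>, whose entries are bounded away from 0. By concavity of the
  logarithm, \<open>\<Sum>i. \<pi>\<^sub>i(t) ln \<mu>\<^sub>i\<^sub>t(\<theta>*)\<close> is a nonpositive submartingale whose drift is at least a
  multiple of the relative entropies between the true signal laws \<open>l\<^sub>i(\<cdot>|\<theta>*)\<close> and the agents'
  one-step predictions \<open>m\<^sub>i\<^sub>t\<close>. Hence \<open>\<Sum>\<^sub>t \<parallel>m\<^sub>i\<^sub>t - l\<^sub>i(\<cdot>|\<theta>*)\<parallel>\<^sup>2\<close> has finite expectation, and so
  has the same sum with \<open>m\<^sub>i\<^sub>,\<^sub>t\<^sub>+\<^sub>1\<close> averaged over all possible signals at time \<open>t + 1\<close>. So almost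
  surely the predictions converge to the true laws whichever signal comes next; comparing the
  different next signals shows that the variance of \<open>l\<^sub>i(s|\<cdot>)\<close> under \<open>\<mu>\<^sub>i\<^sub>t\<close> tends to 0.

  A state that some agent can distinguish from \<open>\<theta>*\<close> therefore loses that agent's belief, and by
  connectivity everybody's. For a state \<open>\<theta>\<close> that nobody can distinguish from \<open>\<theta>*\<close>, the Bayesian
  correction to the averaging step tends to 0, which gives consensus, and
  \<open>\<Sum>i. \<pi>\<^sub>i(t) \<mu>\<^sub>i\<^sub>t(\<theta>)\<close> is a bounded submartingale, which gives convergence.

  Since the signals take finitely many values, conditional expectations are finite sums over the
  next signal, and all random variables are functions of finitely many coordinates of a path.\<close>

section \<open>Uniformly strongly connected chains\<close>

locale usc_chain =
  fixes A :: "nat \<Rightarrow> real^'n::finite^'n" and \<delta> :: real and B :: nat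
  assumes stochastic: "stochastic_matrix (A t)"
    and \<delta>_pos: "\<delta> > 0"
    and \<delta>_le: "A t $ i $ j > 0 \<Longrightarrow> A t $ i $ j \<ge> \<delta>"
    and diag_pos: "A t $ i $ i > 0"
    and B_ge_1: "B \<ge> 1"
    and connected: "strongly_connected
        (with_proj \<lparr> pverts = UNIV,
                     parcs = (\<Union>q\<in>{k * B..<(k + 1) * B}. influence_edges (A q)) \<rparr>)"
begin

lemma A_nonneg: "0 \<le> A t $ i $ j"
  and A_row_sum: "(\<Sum>j\<in>UNIV. A t $ i $ j) = 1"
  using stochastic[of t] by (auto simp: stochastic_matrix_def)

lemma \<delta>_le_1: "\<delta> \<le> 1"
proof -
  fix i :: 'n
  have "\<delta> \<le> A 0 $ i $ i" by (rule \<delta>_le[OF diag_pos])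
  also have "\<dots> \<le> (\<Sum>j\<in>UNIV. A 0 $ i $ j)"
    by (rule member_le_sum) (auto simp: A_nonneg)
  finally show ?thesis by (simp add: A_row_sum)
qed

section \<open>Spread of influence within a time window\<close>

primrec reach :: "nat \<Rightarrow> 'n \<Rightarrow> nat \<Rightarrow> 'n set" where
  "reach t j 0 = {j}"
| "reach t j (Suc k) = {i. \<exists>u\<in>reach t j k. A (t + k) $ i $ u > 0}"

text \<open>One factor \<open>B\<close> pays for waiting until the next block boundary, the other
  \<open>CARD('n)\<close> blocks for influence to spread to everybody.\<close>

definition window :: nat where "window = (CARD('n) + 1) * B"

lemma reach_mono: "k \<le> k' \<Longrightarrow> reach t j k \<subseteq> reach t j k'"
  by (induction k' rule: dec_induct) (use diag_pos in auto)

text \<open>By strong connectivity over block \<open>k\<close>, a path runs from \<open>j\<close> in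
  \<open>R\<close> to some vertex outside \<open>R\<close>; it must leave \<open>R\<close> along
  some edge.\<close>

lemma exists_crossing_edge:
  assumes "j \<in> R" "R \<noteq> UNIV"
  obtains q u v where "k * B \<le> q" "q < (k + 1) * B" "u \<in> R" "v \<notin> R" "A q $ v $ u > 0"
proof -
  let ?G = "with_proj \<lparr> pverts = (UNIV :: 'n set),
                     parcs = (\<Union>q\<in>{k * B..<(k + 1) * B}. influence_edges (A q)) \<rparr>"
  obtain v where v: "v \<notin> R" using assms by auto
  have "j \<rightarrow>\<^sup>*\<^bsub>?G\<^esub> v" using connected[of k] by (auto simp: strongly_connected_def)
  then have "(j, v) \<in> (arcs_ends ?G)\<^sup>*" by (rule reachable_rtranclI)
  then have "v \<notin> R \<longrightarrow> (\<exists>u v. (u, v) \<in> arcs_ends ?G \<and> u \<in> R \<and> v \<notin> R)"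
    by (induction) (use assms in auto)
  with v obtain u v where "(u, v) \<in> arcs_ends ?G" "u \<in> R" "v \<notin> R" by auto
  moreover from this obtain q where "q \<in> {k * B..<(k + 1) * B}" "A q $ v $ u > 0"
    by (auto simp: arcs_ends_def arc_to_ends_def influence_edges_def)
  ultimately show thesis by (intro that[of q u v]) auto
qed

text \<open>Each complete block contains an edge leaving the reached set, so it adds at least one
  agent. The offset \<open>a\<close> aligns the start \<open>t\<close> with a block
  boundary.\<close>

lemma reach_card:
  assumes "t + a = m * B"
  shows "reach t j (a + k * B) = UNIV \<or> card (reach t j (a + k * B)) \<ge> k + 1"
proof (induction k)
  case 0
  have "j \<in> reach t j a" using reach_mono[of 0 a t j] by auto
  then have "card (reach t j a) > 0" by (auto simp: card_gt_0_iff)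
  then show ?case by simp
next
  case (Suc k)
  let ?R = "reach t j (a + k * B)"
  have mono: "?R \<subseteq> reach t j (a + Suc k * B)" by (rule reach_mono) simp
  show ?case
  proof (cases "?R = UNIV")
    case True
    then show ?thesis using mono by auto
  next
    case False
    have "j \<in> ?R" using reach_mono[of 0 "a + k * B" t j] by auto
    from this False obtain q u v where q: "(m + k) * B \<le> q" "q < (m + k + 1) * B"
      and uv: "u \<in> ?R" "v \<notin> ?R" "A q $ v $ u > 0"
      by (rule exists_crossing_edge)
    \<comment> \<open>The crossing edge lies in block \<open>m + k\<close>, so its offset
      \<open>r\<close> from \<open>t\<close> is at least \<open>a + k * B\<close>: \<open>u\<close>
      has already been reached when the edge is used.\<close>
    define r where "r = q - t"
    have r: "q = t + r" "a + k * B \<le> r" "Suc r \<le> a + Suc k * B"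
      using q assms by (auto simp: r_def algebra_simps)
    have "u \<in> reach t j r" using uv(1) reach_mono[OF r(2)] by auto
    then have "v \<in> reach t j (Suc r)" using uv(3) r(1) by auto
    then have "v \<in> reach t j (a + Suc k * B)" using reach_mono[OF r(3)] by auto
    then have "?R \<subset> reach t j (a + Suc k * B)" using mono uv(2) by auto
    then have "card ?R < card (reach t j (a + Suc k * B))"
      by (rule psubset_card_mono[rotated]) simp
    then show ?thesis using Suc False by auto
  qed
qed

lemma reach_window: "reach t j window = UNIV"
proof -
  \<comment> \<open>\<open>m * B\<close> is the first block boundary strictly after
    \<open>t\<close>, at distance \<open>a\<close> of at most \<open>B\<close>.\<close>
  define m where "m = t div B + 1"
  define a where "a = m * B - t"
  have B: "B > 0" using B_ge_1 by simp
  have tB: "t < m * B"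
    unfolding m_def using B by (metis Suc_eq_plus1 dividend_less_div_times mult.commute mult_Suc)
  have mB: "m * B \<le> t + B" unfolding m_def by (simp add: algebra_simps)
  have a: "t + a = m * B" "a \<le> B" using tB mB by (auto simp: a_def)
  have le: "a + CARD('n) * B \<le> window" using a by (simp add: window_def)
  have "reach t j (a + CARD('n) * B) = UNIV"
  proof (rule ccontr)
    assume "\<not> ?thesis"
    with reach_card[OF a(1), of j "CARD('n)"]
    have "card (reach t j (a + CARD('n) * B)) \<ge> CARD('n) + 1" by auto
    moreover have "card (reach t j (a + CARD('n) * B)) \<le> CARD('n)" by (rule card_mono) auto
    ultimately show False by simp
  qed
  then show ?thesis using reach_mono[OF le, of t j] by auto
qed

text \<open>Each positive entry along a path from \<open>j\<close> costs one factor \<eta>. The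
  sequence \<open>x\<close> is kept abstract because the bound serves averages, distances from a
  maximum, and beliefs.\<close>

lemma reach_lower_bound:
  assumes "\<eta> \<ge> 0"
    and step: "\<And>k i j. A (t + k) $ i $ j > 0 \<Longrightarrow> x (Suc k) i \<ge> \<eta> * x k j"
    and "i \<in> reach t j k"
  shows "x k i \<ge> \<eta> ^ k * (x 0 j :: real)"
  using assms(3)
proof (induction k arbitrary: i)
  case (Suc k)
  then obtain u where u: "u \<in> reach t j k" "A (t + k) $ i $ u > 0" by auto
  have "\<eta> * (\<eta> ^ k * x 0 j) \<le> \<eta> * x k u" using Suc.IH[OF u(1)] assms(1) by (rule mult_left_mono)
  also have "\<dots> \<le> x (Suc k) i" by (rule step[OF u(2)])
  finally show ?case by (simp add: mult_ac)
qed auto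

lemma window_lower_bound:
  assumes "\<eta> \<ge> 0"
    and "\<And>k i j. A (t + k) $ i $ j > 0 \<Longrightarrow> x (Suc k) i \<ge> \<eta> * x k j"
  shows "x window i \<ge> \<eta> ^ window * (x 0 j :: real)"
  using assms by (intro reach_lower_bound) (auto simp: reach_window)

section \<open>Contraction of the spread under averaging\<close>

lemma average_step_lower_bound:
  assumes "\<And>j. x $ j \<ge> 0" "A t $ i $ j > 0"
  shows "(A t *v x) $ i \<ge> \<delta> * x $ j"
proof -
  have "\<delta> * x $ j \<le> A t $ i $ j * x $ j" using assms by (intro mult_right_mono \<delta>_le) auto
  also have "\<dots> \<le> (\<Sum>j\<in>UNIV. A t $ i $ j * x $ j)"
    by (rule member_le_sum) (auto simp: A_nonneg assms)
  finally show ?thesis by (simp add: matrix_vector_mult_def)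
qed

lemma average_const: "A t *v (\<chi> i. c) = (\<chi> i. c)"
  by (simp add: vec_eq_iff matrix_vector_mult_def sum_distrib_right[symmetric] A_row_sum)

lemma average_le:
  assumes "\<And>j. x $ j \<le> c" shows "(A t *v x) $ i \<le> c"
proof -
  have "(\<Sum>j\<in>UNIV. A t $ i $ j * x $ j) \<le> (\<Sum>j\<in>UNIV. A t $ i $ j * c)"
    by (intro sum_mono mult_left_mono assms A_nonneg)
  then show ?thesis by (simp add: matrix_vector_mult_def sum_distrib_right[symmetric] A_row_sum)
qed

definition gap :: "real^'n \<Rightarrow> real" where
  "gap x = Max (range (\<lambda>i. x $ i)) - Min (range (\<lambda>i. x $ i))"

lemma diff_le_gap: "x $ i - x $ j \<le> gap x"
  unfolding gap_def by (intro diff_mono) auto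

lemma gap_le:
  assumes "\<And>i j. x $ i - x $ j \<le> c" shows "gap x \<le> c"
proof -
  have "Max (range (\<lambda>i. x $ i)) \<in> range (\<lambda>i. x $ i)" "Min (range (\<lambda>i. x $ i)) \<in> range (\<lambda>i. x $ i)"
    by (auto intro!: Max_in Min_in)
  then obtain i j where "Max (range (\<lambda>i. x $ i)) = x $ i" "Min (range (\<lambda>i. x $ i)) = x $ j"
    by (elim imageE)
  then show ?thesis unfolding gap_def using assms[of i j] by simp
qed

lemma gap_nonneg: "gap x \<ge> 0"
  using diff_le_gap[of x undefined undefined] by simp

text \<open>Averaging never leaves the interval between the initial minimum and maximum, and within
  one window the agent \<open>j\<close> at the minimum pulls every agent below the maximum by a
  fixed fraction of the gap.\<close>

lemma gap_averages_window:
  assumes "\<And>k. y (Suc k) = A (t + k) *v y k"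
  shows "gap (y window) \<le> (1 - \<delta> ^ window) * gap (y 0)"
proof -
  define M where "M = Max (range (\<lambda>i. y 0 $ i))"
  define m where "m = Min (range (\<lambda>i. y 0 $ i))"
  have "m \<in> range (\<lambda>i. y 0 $ i)" unfolding m_def by (rule Min_in) auto
  then obtain j where j: "y 0 $ j = m" by auto
  have M: "y k $ i \<le> M" for k i
    by (induction k arbitrary: i) (auto simp: assms M_def intro!: average_le)
  have lo: "y k $ i \<ge> m" for k i
  proof (induction k arbitrary: i)
    case (Suc k)
    have "(A (t + k) *v (- y k)) $ i \<le> - m" by (rule average_le) (use Suc in auto)
    then show ?case by (simp add: assms matrix_vector_mult_def sum_negf)
  qed (auto simp: m_def)
  \<comment> \<open>The distances from the initial maximum are non-negative and evolve by the same
    averaging, since averaging fixes constant vectors.\<close>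
  have up: "M - y window $ i \<ge> \<delta> ^ window * (M - y 0 $ j)" for i
  proof (rule window_lower_bound[where x = "\<lambda>k i. M - y k $ i" and t = t])
    fix k i j assume pos: "A (t + k) $ i $ j > 0"
    have "(A (t + k) *v ((\<chi> i. M) - y k)) $ i \<ge> \<delta> * ((\<chi> i. M) - y k) $ j"
      by (rule average_step_lower_bound) (use M pos in auto)
    then show "M - y (Suc k) $ i \<ge> \<delta> * (M - y k $ j)"
      by (simp add: matrix_vector_mult_diff_distrib average_const assms)
  qed (use \<delta>_pos in auto)
  show ?thesis
  proof (rule gap_le)
    fix i i'
    have "y window $ i - y window $ i' \<le> M - \<delta> ^ window * (M - m) - m"
      using up[of i] lo[of window i'] j by auto
    then show "y window $ i - y window $ i' \<le> (1 - \<delta> ^ window) * gap (y 0)"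
      by (simp add: gap_def M_def m_def algebra_simps)
  qed
qed

end

text \<open>Iterating the contraction \<open>k\<close> times shows that eventually
  \<open>s t\<close> is at most \<open>(1 - c) ^ k * K + e\<close>, for every \<open>k\<close> and
  every \<open>e > 0\<close>.\<close>

lemma tendsto_0_of_eventual_contraction:
  fixes s \<epsilon> :: "nat \<Rightarrow> real"
  assumes nonneg: "\<And>t. s t \<ge> 0" and bdd: "\<And>t. s t \<le> K"
    and c: "0 < c" "c \<le> 1" and rec: "\<And>t. s (t + L) \<le> (1 - c) * s t + \<epsilon> t"
    and eps: "\<epsilon> \<longlonglongrightarrow> 0"
  shows "s \<longlonglongrightarrow> 0"
proof -
  have bound: "\<exists>T. \<forall>t\<ge>T. s t \<le> (1 - c) ^ k * K + e" if e: "e > 0" for e k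
  proof (induction k)
    case 0
    then show ?case using bdd e by (auto intro!: exI[of _ 0] add_increasing2)
  next
    case (Suc k)
    then obtain T where T: "\<And>t. t \<ge> T \<Longrightarrow> s t \<le> (1 - c) ^ k * K + e" by auto
    \<comment> \<open>The level \<open>c * e\<close> makes the additive term reproduce itself:
      \<open>(1 - c) * e + c * e = e\<close>.\<close>
    have "eventually (\<lambda>t. \<epsilon> t < c * e) sequentially"
      using eps c e by (intro order_tendstoD(2)[of _ 0]) auto
    then obtain T' where T': "\<And>t. t \<ge> T' \<Longrightarrow> \<epsilon> t < c * e" by (auto simp: eventually_sequentially)
    show ?case
    proof (intro exI[of _ "max T T' + L"] allI impI)
      fix t assume t: "max T T' + L \<le> t"
      have "s t \<le> (1 - c) * s (t - L) + \<epsilon> (t - L)" using rec[of "t - L"] t by simp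
      also have "\<dots> \<le> (1 - c) * ((1 - c) ^ k * K + e) + c * e"
        using T[of "t - L"] less_imp_le[OF T'[of "t - L"]] t c by (intro add_mono mult_left_mono) auto
      finally show "s t \<le> (1 - c) ^ Suc k * K + e" by (simp add: algebra_simps)
    qed
  qed
  show ?thesis
  proof (rule LIMSEQ_I)
    fix r :: real assume r: "r > 0"
    have "(\<lambda>k. (1 - c) ^ k * K) \<longlonglongrightarrow> 0 * K"
      using c by (intro tendsto_mult LIMSEQ_power_zero tendsto_const) auto
    then have "eventually (\<lambda>k. (1 - c) ^ k * K < r / 2) sequentially"
      using r by (intro order_tendstoD(2)[of _ 0]) auto
    then obtain k where k: "(1 - c) ^ k * K < r / 2" by (auto simp: eventually_sequentially)
    from bound[of "r / 2" k] r obtain T where T: "\<And>t. t \<ge> T \<Longrightarrow> s t \<le> (1 - c) ^ k * K + r / 2" by auto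
    have "\<bar>s t\<bar> < r" if "t \<ge> T" for t using T[OF that] k nonneg[of t] by linarith
    then show "\<exists>T. \<forall>t\<ge>T. norm (s t - 0) < r" by auto
  qed
qed

context usc_chain
begin

lemma abs_average_le:
  assumes "\<And>j. \<bar>x $ j\<bar> \<le> c" shows "\<bar>(A t *v x) $ i\<bar> \<le> c"
proof -
  have "(A t *v x) $ i \<le> c" by (rule average_le) (use assms abs_le_D1 in blast)
  moreover have "(A t *v (- x)) $ i \<le> c" by (rule average_le) (use assms abs_le_D2 in auto)
  ultimately show ?thesis by (simp add: matrix_vector_mult_def sum_negf abs_le_iff)
qed

text \<open>Over one window the trajectory differs from the unperturbed one by at most the sum of
  the errors, so the gap contracts up to a vanishing term.\<close>

lemma perturbed_consensus:
  fixes x e :: "nat \<Rightarrow> real^'n"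
  assumes step: "\<And>t. x (Suc t) = A (s + t) *v x t + e t"
    and e: "e \<longlonglongrightarrow> 0"
    and bdd: "\<And>t i. \<bar>x t $ i\<bar> \<le> K"
  shows "(\<lambda>t. gap (x t)) \<longlonglongrightarrow> 0"
proof -
  define \<epsilon> where "\<epsilon> t = (\<Sum>k<window. norm (e (t + k)))" for t
  have \<epsilon>: "(\<lambda>t. 2 * \<epsilon> t) \<longlonglongrightarrow> 2 * (\<Sum>k<window. 0)" unfolding \<epsilon>_def
    by (intro tendsto_intros tendsto_sum tendsto_norm_zero) (use LIMSEQ_ignore_initial_segment[OF e] in auto)
  have rec: "gap (x (t + window)) \<le> (1 - \<delta> ^ window) * gap (x t) + 2 * \<epsilon> t" for t
  proof -
    \<comment> \<open>The unperturbed averaging process, restarted at time \<open>t\<close> from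
      \<open>x t\<close>.\<close>
    define y where "y = rec_nat (x t) (\<lambda>k v. A (s + t + k) *v v)"
    have y: "y 0 = x t" "\<And>k. y (Suc k) = A (s + t + k) *v y k" by (auto simp: y_def)
    have diff: "\<bar>(x (t + k) - y k) $ i\<bar> \<le> (\<Sum>l<k. norm (e (t + l)))" for k i
    proof (induction k arbitrary: i)
      case (Suc k)
      have "x (t + Suc k) - y (Suc k) = A (s + t + k) *v (x (t + k) - y k) + e (t + k)"
        by (simp add: step y matrix_vector_mult_diff_distrib add.assoc)
      then have "\<bar>(x (t + Suc k) - y (Suc k)) $ i\<bar> \<le> \<bar>(A (s + t + k) *v (x (t + k) - y k)) $ i\<bar> + \<bar>e (t + k) $ i\<bar>"
        by simp
      also have "\<dots> \<le> (\<Sum>l<k. norm (e (t + l))) + norm (e (t + k))"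
        by (intro add_mono abs_average_le Suc component_le_norm_cart)
      finally show ?case by simp
    qed (simp add: y)
    show ?thesis
    proof (rule gap_le)
      fix i j
      have "x (t + window) $ i - x (t + window) $ j \<le> y window $ i - y window $ j + 2 * \<epsilon> t"
        using diff[of window i] diff[of window j] unfolding \<epsilon>_def by (simp add: abs_le_iff)
      also have "\<dots> \<le> gap (y window) + 2 * \<epsilon> t" by (simp add: diff_le_gap)
      also have "\<dots> \<le> (1 - \<delta> ^ window) * gap (x t) + 2 * \<epsilon> t"
        using gap_averages_window[of y "s + t"] y by simp
      finally show "x (t + window) $ i - x (t + window) $ j \<le> (1 - \<delta> ^ window) * gap (x t) + 2 * \<epsilon> t" .
    qed
  qed
  have "gap (x t) \<le> 2 * K" for t
  proof (rule gap_le)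
    fix i j show "x t $ i - x t $ j \<le> 2 * K" using bdd[of t i] bdd[of t j] by (simp add: abs_le_iff)
  qed
  from gap_nonneg this _ _ rec show ?thesis
  proof (rule tendsto_0_of_eventual_contraction)
    show "0 < \<delta> ^ window" "\<delta> ^ window \<le> 1" using \<delta>_pos \<delta>_le_1 by (auto intro: power_le_one)
    show "(\<lambda>t. 2 * \<epsilon> t) \<longlonglongrightarrow> 0" using \<epsilon> by simp
  qed
qed

section \<open>Products of the chain and the absolute probability sequence\<close>

primrec transition :: "nat \<Rightarrow> nat \<Rightarrow> real^'n^'n" where
  "transition t 0 = mat 1"
| "transition t (Suc k) = A (t + k) ** transition t k"

text \<open>Splitting off the earliest factor instead of the latest one is what relates the limits
  started at \<open>t\<close> and at \<open>Suc t\<close>.\<close>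

lemma transition_Suc_right: "transition t (Suc k) = transition (Suc t) k ** A t"
proof (induction k)
  case (Suc k)
  have "transition t (Suc (Suc k)) = A (t + Suc k) ** (transition (Suc t) k ** A t)"
    using Suc by (simp only: transition.simps)
  then show ?case by (simp add: matrix_mul_assoc)
qed simp

lemma transition_column: "transition t (Suc k) *v v = A (t + k) *v (transition t k *v v)"
  by (simp add: matrix_vector_mul_assoc)

lemma transition_bounds:
  assumes "\<And>j. a \<le> v $ j" "\<And>j. v $ j \<le> b"
  shows "a \<le> (transition t k *v v) $ i \<and> (transition t k *v v) $ i \<le> b"
proof (induction k arbitrary: i)
  case (Suc k)
  have "(A (t + k) *v (transition t k *v v)) $ i \<le> b" using Suc by (intro average_le) auto
  moreover have "(A (t + k) *v (- (transition t k *v v))) $ i \<le> - a" using Suc by (intro average_le) auto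
  ultimately show ?case
    unfolding transition_column by (simp add: matrix_vector_mult_def sum_negf)
qed (use assms in auto)

text \<open>The largest coordinate decreases and the gap tends to 0, so all coordinates are squeezed
  to the limit of the maximum.\<close>

lemma transition_converges:
  "\<exists>c. \<forall>i. (\<lambda>k. (transition t k *v v) $ i) \<longlonglongrightarrow> c"
proof -
  define y where "y k = transition t k *v v" for k
  have y: "y (Suc k) = A (t + k) *v y k" for k unfolding y_def by (rule transition_column)
  define K where "K = Max (range (\<lambda>i. \<bar>v $ i\<bar>))"
  have v: "\<bar>v $ i\<bar> \<le> K" for i unfolding K_def by auto
  have bdd: "\<bar>y k $ i\<bar> \<le> K" for k i
    using transition_bounds[of "-K" v K t k i] v unfolding y_def by (auto simp: abs_le_iff minus_le_iff)
  have "(\<lambda>k. gap (y k)) \<longlonglongrightarrow> 0"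
    by (rule perturbed_consensus[where e = "\<lambda>_. 0" and s = t and K = K]) (auto simp: y bdd)
  define M where "M k = Max (range (\<lambda>i. y k $ i))" for k
  have le_M: "y k $ i \<le> M k" for k i unfolding M_def by auto
  have M_in: "\<exists>i. M k = y k $ i" for k
  proof -
    have "M k \<in> range (\<lambda>i. y k $ i)" unfolding M_def by (rule Max_in) auto
    then show ?thesis by auto
  qed
  have "decseq M"
  proof (rule decseq_SucI)
    fix k
    obtain i where "M (Suc k) = y (Suc k) $ i" using M_in by auto
    then show "M (Suc k) \<le> M k" using le_M by (simp add: y average_le)
  qed
  moreover have "- K \<le> M k" for k
    using bdd[of k undefined] le_M[of k undefined] by linarith
  ultimately obtain c where c: "M \<longlonglongrightarrow> c" using decseq_convergent[of M "- K"] by blast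
  have "(\<lambda>k. y k $ i) \<longlonglongrightarrow> c" for i
  proof (rule tendsto_sandwich)
    have "M k - gap (y k) \<le> y k $ i" for k
    proof -
      obtain i' where "M k = y k $ i'" using M_in by auto
      then show ?thesis using diff_le_gap[of "y k" i' i] by simp
    qed
    then show "eventually (\<lambda>k. M k - gap (y k) \<le> y k $ i) sequentially" by auto
    show "(\<lambda>k. M k - gap (y k)) \<longlonglongrightarrow> c"
      using tendsto_diff[OF c \<open>(\<lambda>k. gap (y k)) \<longlonglongrightarrow> 0\<close>] by simp
  qed (use c le_M in auto)
  then show ?thesis unfolding y_def by blast
qed

text \<open>Kolmogorov's absolute probability sequence. All rows of the products have the same
  limit, so the arbitrary row \<open>undefined\<close> serves to define it.\<close>

definition abs_prob :: "nat \<Rightarrow> real^'n" where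
  "abs_prob t = (\<chi> j. lim (\<lambda>k. transition t k $ undefined $ j))"

lemma transition_tendsto_abs_prob: "(\<lambda>k. transition t k $ i $ j) \<longlonglongrightarrow> abs_prob t $ j"
proof -
  have col: "(transition t k *v axis j 1) $ i = transition t k $ i $ j" for k i
    by (simp add: matrix_vector_mult_basis column_def)
  obtain c where c: "\<And>i. (\<lambda>k. transition t k $ i $ j) \<longlonglongrightarrow> c"
    using transition_converges[of t "axis j 1"] by (auto simp: col)
  have "abs_prob t $ j = c" by (simp add: abs_prob_def limI[OF c])
  then show ?thesis using c by simp
qed

lemma abs_prob_step: "(\<Sum>i\<in>UNIV. abs_prob (Suc t) $ i * A t $ i $ j) = abs_prob t $ j"
proof (rule LIMSEQ_unique)
  show "(\<lambda>k. transition t (Suc k) $ undefined $ j) \<longlonglongrightarrow> abs_prob t $ j"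
    by (rule LIMSEQ_Suc[OF transition_tendsto_abs_prob])
  have "(\<lambda>k. \<Sum>i\<in>UNIV. transition (Suc t) k $ undefined $ i * A t $ i $ j)
      \<longlonglongrightarrow> (\<Sum>i\<in>UNIV. abs_prob (Suc t) $ i * A t $ i $ j)"
    by (intro tendsto_sum tendsto_mult tendsto_const transition_tendsto_abs_prob)
  then show "(\<lambda>k. transition t (Suc k) $ undefined $ j)
      \<longlonglongrightarrow> (\<Sum>i\<in>UNIV. abs_prob (Suc t) $ i * A t $ i $ j)"
    unfolding transition_Suc_right by (simp add: matrix_matrix_mult_def)
qed

lemma abs_prob_sum: "(\<Sum>j\<in>UNIV. abs_prob t $ j) = 1"
proof (rule LIMSEQ_unique)
  show "(\<lambda>k. \<Sum>j\<in>UNIV. transition t k $ undefined $ j) \<longlonglongrightarrow> (\<Sum>j\<in>UNIV. abs_prob t $ j)"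
    by (intro tendsto_sum transition_tendsto_abs_prob)
  have "(\<Sum>j\<in>UNIV. transition t k $ undefined $ j) = 1" for k
    using transition_bounds[of 1 "\<chi> i. 1" 1 t k undefined] by (simp add: matrix_vector_mult_def)
  then show "(\<lambda>k. \<Sum>j\<in>UNIV. transition t k $ undefined $ j) \<longlonglongrightarrow> 1" by simp
qed

text \<open>After one window, column \<open>j\<close> of the product has all entries at least
  \<open>\<delta> ^ window\<close>, and further averaging preserves a common lower bound.\<close>

lemma abs_prob_lower_bound: "abs_prob t $ j \<ge> \<delta> ^ window"
proof -
  define y where "y k = transition t k *v axis j 1" for k
  have y: "y (Suc k) = A (t + k) *v y k" for k unfolding y_def by (rule transition_column)
  have nonneg: "y k $ i \<ge> 0" for k i
    using transition_bounds[of 0 "axis j 1" 1 t k i] by (simp add: y_def axis_def)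
  have "y window $ i \<ge> \<delta> ^ window * y 0 $ j" for i
    by (rule window_lower_bound[where x = "\<lambda>k i. y k $ i" and t = t])
       (use \<delta>_pos nonneg average_step_lower_bound y in auto)
  then have base: "y window $ i \<ge> \<delta> ^ window" for i by (simp add: y_def axis_def)
  have "y (window + k) $ i \<ge> \<delta> ^ window" for k i
  proof (induction k arbitrary: i)
    case (Suc k)
    have "(A (t + (window + k)) *v (- y (window + k))) $ i \<le> - (\<delta> ^ window)"
      using Suc by (intro average_le) auto
    then show ?case by (simp add: y matrix_vector_mult_def sum_negf)
  qed (simp add: base)
  moreover have "(\<lambda>k. y (k + window) $ undefined) \<longlonglongrightarrow> abs_prob t $ j"
    by (rule LIMSEQ_ignore_initial_segment)
       (simp add: y_def matrix_vector_mult_basis column_def transition_tendsto_abs_prob)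
  ultimately show ?thesis
    by (intro LIMSEQ_le_const) (auto simp: add.commute)
qed

lemma abs_prob_nonneg: "abs_prob t $ j \<ge> 0"
  using abs_prob_lower_bound[of t j] \<delta>_pos by (meson order_trans zero_le_power less_imp_le)

text \<open>Invariance in the form needed for potentials: the averaging step leaves the weighted
  total unchanged, so any drift comes from the signals.\<close>

lemma abs_prob_average:
  "(\<Sum>i\<in>UNIV. abs_prob (Suc t) $ i * (\<Sum>j\<in>UNIV. A t $ i $ j * f j)) = (\<Sum>j\<in>UNIV. abs_prob t $ j * f j)"
proof -
  have "(\<Sum>i\<in>UNIV. abs_prob (Suc t) $ i * (\<Sum>j\<in>UNIV. A t $ i $ j * f j))
      = (\<Sum>j\<in>UNIV. (\<Sum>i\<in>UNIV. abs_prob (Suc t) $ i * A t $ i $ j) * f j)"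
    by (simp add: sum_distrib_left sum_distrib_right mult.assoc) (rule sum.swap)
  then show ?thesis by (simp add: abs_prob_step)
qed

end

section \<open>Submartingales of a finite-valued i.i.d. process\<close>

locale iid_process = prob_space M for M :: "'w measure" +
  fixes X :: "nat \<Rightarrow> 'w \<Rightarrow> 'b" and p :: "'b pmf" and \<Omega> :: "'b set"
  assumes finite_\<Omega>: "finite \<Omega>"
    and set_p: "set_pmf p \<subseteq> \<Omega>"
    and indep: "indep_vars (\<lambda>_. count_space UNIV) X {1..}"
    and distr_X: "t \<ge> 1 \<Longrightarrow> distr M (count_space UNIV) (X t) = measure_pmf p"
    and X_in: "t \<ge> 1 \<Longrightarrow> x \<in> space M \<Longrightarrow> X t x \<in> \<Omega>"
begin

section \<open>Functionals of finitely many signals\<close>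

definition path :: "'w \<Rightarrow> nat \<Rightarrow> 'b" where
  "path x = (\<lambda>t. X t x)"

definition admissible :: "(nat \<Rightarrow> 'b) \<Rightarrow> bool" where
  "admissible w \<longleftrightarrow> (\<forall>t\<ge>1. w t \<in> \<Omega>)"

text \<open>Stands in for measurability with respect to the first \<open>t\<close> signals; the
  value at time 0 carries no signal and is excluded.\<close>

definition adapted :: "nat \<Rightarrow> ((nat \<Rightarrow> 'b) \<Rightarrow> 'c) \<Rightarrow> bool" where
  "adapted t f \<longleftrightarrow> (\<forall>w w'. (\<forall>s\<in>{1..t}. w s = w' s) \<longrightarrow> f w = f w')"

text \<open>A pathwise version of the conditional expectation given the first \<open>t\<close>
  signals, intended for functionals adapted to \<open>Suc t\<close>.\<close>

definition cexp :: "nat \<Rightarrow> ((nat \<Rightarrow> 'b) \<Rightarrow> real) \<Rightarrow> (nat \<Rightarrow> 'b) \<Rightarrow> real" where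
  "cexp t f w = (\<Sum>a\<in>\<Omega>. pmf p a * f (w(Suc t := a)))"

definition mean :: "((nat \<Rightarrow> 'b) \<Rightarrow> real) \<Rightarrow> real" where
  "mean f = expectation (\<lambda>x. f (path x))"

lemma admissible_path: "x \<in> space M \<Longrightarrow> admissible (path x)"
  by (auto simp: admissible_def path_def X_in)

lemma adaptedI:
  assumes "\<And>w w'. (\<And>s. 1 \<le> s \<Longrightarrow> s \<le> t \<Longrightarrow> w s = w' s) \<Longrightarrow> f w = f w'"
  shows "adapted t f"
  unfolding adapted_def by (intro allI impI assms) simp

lemma adaptedD:
  assumes "adapted t f" "\<And>s. 1 \<le> s \<Longrightarrow> s \<le> t \<Longrightarrow> w s = w' s"
  shows "f w = f w'"
proof -
  have "\<forall>s\<in>{1..t}. w s = w' s" using assms(2) by simp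
  with assms(1) show ?thesis unfolding adapted_def by blast
qed

lemma adapted_mono:
  assumes "adapted t f" "t \<le> t'" shows "adapted t' f"
  by (rule adaptedI, rule adaptedD[OF assms(1)]) (use assms(2) in auto)

lemma adapted_upd: "adapted t f \<Longrightarrow> f (w(Suc t := a)) = f w"
  by (rule adaptedD[of t f]) auto

lemma adapted_compose2:
  assumes "adapted t f" "adapted t g" shows "adapted t (\<lambda>w. h (f w) (g w))"
proof (rule adaptedI)
  fix w w' :: "nat \<Rightarrow> 'b"
  assume eq: "\<And>s. 1 \<le> s \<Longrightarrow> s \<le> t \<Longrightarrow> w s = w' s"
  have "f w = f w'" "g w = g w'" by (rule adaptedD[OF assms(1) eq], assumption+) (rule adaptedD[OF assms(2) eq])
  then show "h (f w) (g w) = h (f w') (g w')" by simp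
qed

lemma adapted_compose:
  assumes "adapted t f" shows "adapted t (\<lambda>w. h (f w))"
  using adapted_compose2[OF assms assms, of "\<lambda>a _. h a"] .

lemma adapted_const: "adapted t (\<lambda>_. c)"
  by (simp add: adapted_def)

lemma adapted_sum:
  assumes "\<And>i. i \<in> I \<Longrightarrow> adapted t (f i)"
  shows "adapted t (\<lambda>w. \<Sum>i\<in>I. f i w)"
proof (rule adaptedI)
  fix w w' :: "nat \<Rightarrow> 'b"
  assume eq: "\<And>s. 1 \<le> s \<Longrightarrow> s \<le> t \<Longrightarrow> w s = w' s"
  have "f i w = f i w'" if "i \<in> I" for i by (rule adaptedD[OF assms[OF that] eq])
  then show "(\<Sum>i\<in>I. f i w) = (\<Sum>i\<in>I. f i w')" by (rule sum.cong[OF refl])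
qed

lemma adapted_cexp: "adapted (Suc t) f \<Longrightarrow> adapted t (cexp t f)"
  unfolding cexp_def by (rule adaptedI, intro sum.cong refl arg_cong2[where f = "(*)"], rule adaptedD[of "Suc t" f]) auto

lemma sum_p: "(\<Sum>a\<in>\<Omega>. pmf p a) = 1"
  using finite_\<Omega> set_p by (rule sum_pmf_eq_1)

lemma cexp_mult_left:
  assumes "adapted t g" shows "cexp t (\<lambda>w. g w * f w) w = g w * cexp t f w"
  unfolding cexp_def adapted_upd[OF assms] sum_distrib_left by (intro sum.cong) auto

lemma X_measurable [measurable]: "t \<ge> 1 \<Longrightarrow> X t \<in> measurable M (count_space UNIV)"
  using indep by (auto simp: indep_vars_def2)

section \<open>Expectations as finite sums over histories\<close>

definition cylinder :: "nat \<Rightarrow> (nat \<Rightarrow> 'b) \<Rightarrow> 'w set" where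
  "cylinder t h = {x\<in>space M. \<forall>s\<in>{1..t}. X s x = h s}"

lemma cylinder_measurable [measurable]: "cylinder t h \<in> sets M"
proof -
  have "cylinder t h = (\<Inter>s\<in>{1..t}. X s -` {h s} \<inter> space M) \<inter> space M" by (auto simp: cylinder_def)
  also have "\<dots> \<in> sets M"
  proof (cases "t = 0")
    case False
    then have "(\<Inter>s\<in>{1..t}. X s -` {h s} \<inter> space M) \<in> sets M"
      by (intro sets.finite_INT) (auto intro!: measurable_sets[OF X_measurable])
    then show ?thesis by auto
  qed auto
  finally show ?thesis .
qed

lemma prob_cylinder: "prob (cylinder t h) = (\<Prod>s\<in>{1..t}. pmf p (h s))"
proof (cases "t = 0")
  case True
  then show ?thesis by (simp add: cylinder_def prob_space)
next
  case False
  have "cylinder t h = (\<Inter>s\<in>{1..t}. X s -` {h s} \<inter> space M)" using False by (auto simp: cylinder_def)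
  also have "prob \<dots> = (\<Prod>s\<in>{1..t}. prob (X s -` {h s} \<inter> space M))"
    using indep False unfolding indep_vars_def2 by (intro indep_setsD[of _ "{1..}"]) auto
  also have "\<dots> = (\<Prod>s\<in>{1..t}. pmf p (h s))"
  proof (rule prod.cong[OF refl])
    fix s assume s: "s \<in> {1..t}"
    have "prob (X s -` {h s} \<inter> space M) = measure (distr M (count_space UNIV) (X s)) {h s}"
      using s by (subst measure_distr) auto
    also have "\<dots> = pmf p (h s)" using s by (simp add: distr_X measure_pmf_single)
    finally show "prob (X s -` {h s} \<inter> space M) = pmf p (h s)" .
  qed
  finally show ?thesis .
qed

text \<open>Exactly one history of length \<open>t\<close> matches the path, so an adapted
  functional is a finite combination of cylinder indicators. Measurability and integrability follow
  from this.\<close>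

lemma adapted_expand:
  fixes f :: "(nat \<Rightarrow> 'b) \<Rightarrow> real"
  assumes "adapted t f" "x \<in> space M"
  shows "f (path x) = (\<Sum>h\<in>PiE {1..t} (\<lambda>_. \<Omega>). f h * indicator (cylinder t h) x)"
proof -
  let ?h = "restrict (path x) {1..t}"
  have h: "?h \<in> PiE {1..t} (\<lambda>_. \<Omega>)" using assms(2) by (auto simp: path_def X_in)
  have "(\<Sum>h\<in>PiE {1..t} (\<lambda>_. \<Omega>). f h * indicator (cylinder t h) x)
      = (\<Sum>h\<in>PiE {1..t} (\<lambda>_. \<Omega>). if h = ?h then f h else 0)"
  proof (intro sum.cong refl)
    fix h assume h': "h \<in> PiE {1..t} (\<lambda>_. \<Omega>)"
    have "x \<in> cylinder t h \<longleftrightarrow> h = ?h"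
    proof
      assume "x \<in> cylinder t h"
      then show "h = ?h" by (intro PiE_ext[OF h' h]) (simp add: cylinder_def path_def)
    next
      assume "h = ?h"
      then have "h s = X s x" if "s \<in> {1..t}" for s using that by (simp add: path_def)
      then show "x \<in> cylinder t h" using assms(2) by (simp add: cylinder_def)
    qed
    then show "f h * indicator (cylinder t h) x = (if h = ?h then f h else 0)"
      by (auto simp: indicator_def)
  qed
  also have "\<dots> = f ?h" using h by (simp add: finite_PiE finite_\<Omega>)
  also have "\<dots> = f (path x)" by (rule adaptedD[OF assms(1)]) auto
  finally show ?thesis by simp
qed

lemma adapted_has_integral:
  fixes f :: "(nat \<Rightarrow> 'b) \<Rightarrow> real"
  assumes "adapted t f"
  shows "has_bochner_integral M (\<lambda>x. f (path x))
    (\<Sum>h\<in>PiE {1..t} (\<lambda>_. \<Omega>). f h * (\<Prod>s\<in>{1..t}. pmf p (h s)))"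
proof -
  let ?g = "\<lambda>x. \<Sum>h\<in>PiE {1..t} (\<lambda>_. \<Omega>). f h * indicator (cylinder t h) x"
  let ?I = "\<Sum>h\<in>PiE {1..t} (\<lambda>_. \<Omega>). f h * (\<Prod>s\<in>{1..t}. pmf p (h s))"
  have "has_bochner_integral M ?g ?I"
    unfolding prob_cylinder[symmetric]
    by (intro has_bochner_integral_sum has_bochner_integral_mult_right has_bochner_integral_real_indicator
          cylinder_measurable) (simp add: emeasure_eq_measure)
  moreover have "has_bochner_integral M (\<lambda>x. f (path x)) ?I \<longleftrightarrow> has_bochner_integral M ?g ?I"
    by (intro has_bochner_integral_cong refl adapted_expand[OF assms])
  ultimately show ?thesis by blast
qed

lemma adapted_integrable:
  fixes f :: "(nat \<Rightarrow> 'b) \<Rightarrow> real"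
  shows "adapted t f \<Longrightarrow> integrable M (\<lambda>x. f (path x))"
  using adapted_has_integral by (auto simp: has_bochner_integral_iff)

lemma adapted_measurable:
  fixes f :: "(nat \<Rightarrow> 'b) \<Rightarrow> real"
  shows "adapted t f \<Longrightarrow> (\<lambda>x. f (path x)) \<in> borel_measurable M"
  by (rule borel_measurable_integrable[OF adapted_integrable])

lemma mean_eq:
  "adapted t f \<Longrightarrow> mean f = (\<Sum>h\<in>PiE {1..t} (\<lambda>_. \<Omega>). f h * (\<Prod>s\<in>{1..t}. pmf p (h s)))"
  unfolding mean_def by (rule has_bochner_integral_integral_eq[OF adapted_has_integral])

text \<open>The tower property: a history of length \<open>t + 1\<close> is a history of length
  \<open>t\<close> with one more signal, and by independence its weight factors accordingly.\<close>

lemma mean_cexp: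
  assumes "adapted (Suc t) f"
  shows "mean (cexp t f) = mean f"
proof -
  have ins: "{1..Suc t} = insert (Suc t) {1..t}" by auto
  have "mean f = (\<Sum>h\<in>(\<lambda>(y, g). g(Suc t := y)) ` (\<Omega> \<times> PiE {1..t} (\<lambda>_. \<Omega>)). f h * (\<Prod>s\<in>insert (Suc t) {1..t}. pmf p (h s)))"
    by (simp only: mean_eq[OF assms] ins PiE_insert_eq)
  also have "\<dots> = (\<Sum>(y, g)\<in>\<Omega> \<times> PiE {1..t} (\<lambda>_. \<Omega>). f (g(Suc t := y)) * (pmf p y * (\<Prod>s\<in>{1..t}. pmf p (g s))))"
  proof (subst sum.reindex)
    show "inj_on (\<lambda>(y, g). g(Suc t := y)) (\<Omega> \<times> PiE {1..t} (\<lambda>_. \<Omega>))"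
      by (rule inj_combinator) simp
    have "(\<Prod>s\<in>insert (Suc t) {1..t}. pmf p ((g(Suc t := y)) s)) = pmf p y * (\<Prod>s\<in>{1..t}. pmf p (g s))" for g y
    proof -
      have "(\<Prod>s\<in>{1..t}. pmf p ((g(Suc t := y)) s)) = (\<Prod>s\<in>{1..t}. pmf p (g s))"
        by (intro prod.cong) auto
      then show ?thesis by (simp add: prod.insert)
    qed
    then show "(sum ((\<lambda>h. f h * (\<Prod>s\<in>insert (Suc t) {1..t}. pmf p (h s))) \<circ> (\<lambda>(y, g). g(Suc t := y)))
         (\<Omega> \<times> PiE {1..t} (\<lambda>_. \<Omega>))) = (\<Sum>(y, g)\<in>\<Omega> \<times> PiE {1..t} (\<lambda>_. \<Omega>). f (g(Suc t := y)) * (pmf p y * (\<Prod>s\<in>{1..t}. pmf p (g s))))"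
      by (intro sum.cong) auto
  qed
  also have "\<dots> = (\<Sum>g\<in>PiE {1..t} (\<lambda>_. \<Omega>). \<Sum>y\<in>\<Omega>. f (g(Suc t := y)) * (pmf p y * (\<Prod>s\<in>{1..t}. pmf p (g s))))"
    by (subst sum.cartesian_product[symmetric]) (rule sum.swap)
  also have "\<dots> = mean (cexp t f)"
    by (simp add: mean_eq[OF adapted_cexp[OF assms]] cexp_def sum_distrib_left sum_distrib_right mult_ac)
  finally show ?thesis by simp
qed

lemma mean_mono:
  assumes "adapted t f" "adapted t g" "\<And>w. admissible w \<Longrightarrow> f w \<le> g w"
  shows "mean f \<le> mean g"
  unfolding mean_def
  by (intro integral_mono adapted_integrable[OF assms(1)] adapted_integrable[OF assms(2)] assms(3) admissible_path)

lemma mean_add: "adapted t f \<Longrightarrow> adapted t g \<Longrightarrow> mean (\<lambda>w. f w + g w) = mean f + mean g"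
  and mean_diff: "adapted t f \<Longrightarrow> adapted t g \<Longrightarrow> mean (\<lambda>w. f w - g w) = mean f - mean g"
  unfolding mean_def by (simp_all add: adapted_integrable)

lemma mean_const: "mean (\<lambda>_. c) = c"
  unfolding mean_def by (simp add: prob_space)

lemma mean_mult_left: "mean (\<lambda>w. c * f w) = c * mean f"
  unfolding mean_def by simp

text \<open>By monotone convergence the series of the \<open>f t\<close> has a finite integral, so
  it is almost surely finite and its terms tend to 0.\<close>

lemma summable_mean_AE_tendsto_0:
  assumes ad: "\<And>t. adapted t (f t)" and nonneg: "\<And>t w. admissible w \<Longrightarrow> f t w \<ge> 0"
    and bound: "\<And>T. (\<Sum>t<T. mean (f t)) \<le> K"
  shows "AE x in M. (\<lambda>t. f t (path x)) \<longlonglongrightarrow> 0"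
proof -
  have mean_nonneg: "mean (f t) \<ge> 0" for t
    unfolding mean_def by (intro integral_nonneg_AE AE_I2 nonneg admissible_path)
  have nn: "(\<integral>\<^sup>+x. ennreal (f t (path x)) \<partial>M) = ennreal (mean (f t))" for t
    unfolding mean_def by (intro nn_integral_eq_integral adapted_integrable[OF ad] AE_I2 nonneg admissible_path)
  have "(\<integral>\<^sup>+x. (\<Sum>t. ennreal (f t (path x))) \<partial>M) = (\<Sum>t. \<integral>\<^sup>+x. ennreal (f t (path x)) \<partial>M)"
    using adapted_measurable[OF ad] by (intro nn_integral_suminf) auto
  also have "\<dots> \<le> ennreal K"
  proof (rule suminf_le_const)
    fix T
    have "(\<Sum>t<T. \<integral>\<^sup>+x. ennreal (f t (path x)) \<partial>M) = ennreal (\<Sum>t<T. mean (f t))"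
      by (simp add: nn sum_ennreal mean_nonneg)
    also have "\<dots> \<le> ennreal K" by (intro ennreal_leI bound)
    finally show "(\<Sum>t<T. \<integral>\<^sup>+x. ennreal (f t (path x)) \<partial>M) \<le> ennreal K" .
  qed auto
  finally have "(\<integral>\<^sup>+x. (\<Sum>t. ennreal (f t (path x))) \<partial>M) \<noteq> \<infinity>"
    by (auto simp: top_unique)
  then have "AE x in M. (\<Sum>t. ennreal (f t (path x))) \<noteq> \<infinity>"
    using adapted_measurable[OF ad] by (intro nn_integral_PInf_AE) auto
  moreover have "AE x in M. \<forall>t. f t (path x) \<ge> 0" by (intro AE_I2 allI nonneg admissible_path)
  ultimately show ?thesis
  proof eventually_elim
    case (elim x)
    then have "summable (\<lambda>t. f t (path x))"
      by (intro summable_suminf_not_top) auto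
    then show ?case by (rule summable_LIMSEQ_zero)
  qed
qed


section \<open>Convergence of bounded submartingales\<close>

context
  fixes Y :: "nat \<Rightarrow> (nat \<Rightarrow> 'b) \<Rightarrow> real"
  assumes ad: "\<And>t. adapted t (Y t)"
    and bounds: "\<And>t w. admissible w \<Longrightarrow> 0 \<le> Y t w \<and> Y t w \<le> 1"
    and submart: "\<And>t w. admissible w \<Longrightarrow> Y t w \<le> cexp t (Y (Suc t)) w"
begin

lemma adapted_Suc: "adapted (Suc t) (Y t)"
  by (rule adapted_mono[OF ad]) simp

text \<open>Conditioning on the first \<open>t\<close> signals pulls out the known factor
  \<open>g\<close> and leaves the non-negative drift.\<close>

lemma mean_increment_nonneg:
  assumes g: "adapted t g" "\<And>w. admissible w \<Longrightarrow> 0 \<le> g w"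
  shows "0 \<le> mean (\<lambda>w. g w * (Y (Suc t) w - Y t w))"
proof -
  have a: "adapted (Suc t) (\<lambda>w. g w * (Y (Suc t) w - Y t w))"
    by (intro adapted_compose2[where h = "(*)"] adapted_compose2[where h = "(-)"] ad adapted_Suc adapted_mono[OF g(1)]) simp
  have eq: "cexp t (\<lambda>w. g w * (Y (Suc t) w - Y t w)) w = g w * (cexp t (Y (Suc t)) w - Y t w)" for w
  proof -
    have "cexp t (\<lambda>w. Y (Suc t) w - Y t w) w = cexp t (Y (Suc t)) w - Y t w"
      using adapted_upd[OF ad, of t]
      by (simp add: cexp_def right_diff_distrib sum_subtractf sum_distrib_right[symmetric] sum_p)
    then show ?thesis by (simp add: cexp_mult_left[OF g(1)])
  qed
  have "mean (\<lambda>_. 0) \<le> mean (cexp t (\<lambda>w. g w * (Y (Suc t) w - Y t w)))"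
    by (rule mean_mono[where t = t]) (auto simp: adapted_const adapted_cexp[OF a] eq g(2) submart)
  then show ?thesis by (simp add: mean_cexp[OF a] mean_const)
qed

text \<open>For \<open>\<bar>g\<bar> \<le> 1\<close> the term \<open>2 * mean (Y t)\<close> pays for the cross terms
  \<open>2 * g * (Y (Suc t) - Y t)\<close>, so that the increments of the energy control the
  oscillation of \<open>Y\<close> after any given time.\<close>

definition energy :: "nat \<Rightarrow> real" where
  "energy t = mean (\<lambda>w. (Y t w)\<^sup>2) + 2 * mean (Y t)"

text \<open>With \<open>D\<close> the increment of \<open>Y\<close>, the right side exceeds the left
  by exactly \<open>2 * mean ((1 - g) * D) + 2 * mean (Y t * D)\<close>; both coefficients
  \<open>1 - g\<close> and \<open>Y t\<close> are non-negative and known at time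
  \<open>t\<close>.\<close>

lemma energy_increment:
  assumes g: "adapted t g" "\<And>w. admissible w \<Longrightarrow> \<bar>g w\<bar> \<le> 1"
  shows "mean (\<lambda>w. 2 * g w * (Y (Suc t) w - Y t w) + (Y (Suc t) w - Y t w)\<^sup>2) \<le> energy (Suc t) - energy t"
proof -
  note ads = adapted_compose2[where h = "(*)"] adapted_compose2[where h = "(-)"] adapted_compose2[where h = "(+)"]
    adapted_compose[where h = "\<lambda>x. x\<^sup>2"] adapted_const ad adapted_Suc adapted_mono[OF g(1) le_SucI[OF order_refl]] g(1)
  let ?D = "\<lambda>w. Y (Suc t) w - Y t w"
  have "0 \<le> mean (\<lambda>w. (1 - g w) * ?D w)"
    by (rule mean_increment_nonneg) (intro ads, use g(2) in \<open>fastforce simp: abs_le_iff\<close>)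
  moreover have "0 \<le> mean (\<lambda>w. Y t w * ?D w)"
    by (rule mean_increment_nonneg) (intro ads, use bounds in auto)
  moreover have "energy (Suc t) - energy t - mean (\<lambda>w. 2 * g w * ?D w + (?D w)\<^sup>2)
      = 2 * mean (\<lambda>w. (1 - g w) * ?D w) + 2 * mean (\<lambda>w. Y t w * ?D w)"
  proof -
    have "2 * mean (\<lambda>w. (1 - g w) * ?D w) + 2 * mean (\<lambda>w. Y t w * ?D w) + mean (\<lambda>w. 2 * g w * ?D w + (?D w)\<^sup>2)
        = mean (\<lambda>w. 2 * ((1 - g w) * ?D w) + 2 * (Y t w * ?D w) + (2 * g w * ?D w + (?D w)\<^sup>2))"
      by (subst mean_add[of "Suc t"], (intro ads)+)+ (simp add: mean_mult_left)
    also have "\<dots> = mean (\<lambda>w. ((Y (Suc t) w)\<^sup>2 + 2 * Y (Suc t) w) - ((Y t w)\<^sup>2 + 2 * Y t w))"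
      by (rule arg_cong[where f = mean]) (auto simp: fun_eq_iff power2_eq_square algebra_simps)
    also have "\<dots> = energy (Suc t) - energy t"
      unfolding energy_def
      by (subst mean_diff[of "Suc t"], (intro ads)+, (subst mean_add[of "Suc t"], (intro ads)+)+) (simp add: mean_mult_left)
    finally show ?thesis by simp
  qed
  ultimately show ?thesis by simp
qed

lemma energy_mono: "incseq energy"
proof (rule incseq_SucI)
  fix t
  have "mean (\<lambda>_. 0) \<le> mean (\<lambda>w. 2 * 0 * (Y (Suc t) w - Y t w) + (Y (Suc t) w - Y t w)\<^sup>2)"
    by (rule mean_mono[where t = "Suc t"])
       (auto intro!: adapted_const adapted_compose[where h = "\<lambda>x. x\<^sup>2"] adapted_compose2[where h = "(-)"] ad adapted_Suc)
  also have "\<dots> \<le> energy (Suc t) - energy t"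
    by (rule energy_increment) (auto simp: adapted_const)
  finally show "energy t \<le> energy (Suc t)" by (simp add: mean_const)
qed

lemma energy_le: "energy t \<le> 3"
proof -
  have "mean (Y t) \<le> mean (\<lambda>_. 1)"
    by (rule mean_mono[where t = t]) (auto simp: ad adapted_const bounds)
  moreover have "mean (\<lambda>w. (Y t w)\<^sup>2) \<le> mean (\<lambda>_. 1)"
    by (rule mean_mono[where t = t])
       (auto intro!: adapted_compose[where h = "\<lambda>x. x\<^sup>2"] simp: ad adapted_const bounds power_le_one)
  ultimately show ?thesis by (simp add: energy_def mean_const)
qed

text \<open>A maximal inequality by stopping: \<open>G t\<close> says that the path has stayed
  within \<epsilon> of its value at time \<open>T\<close>. A path that has left is charged
  \<epsilon> squared, the others their squared displacement, and each step raises this total by at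
  most the energy increment.\<close>

lemma maximal_inequality:
  fixes T :: nat
  assumes "\<epsilon> > 0"
  defines "G \<equiv> \<lambda>t w. \<forall>s\<in>{T..T + t}. \<bar>Y s w - Y T w\<bar> < \<epsilon>"
  shows "\<epsilon>\<^sup>2 * mean (\<lambda>w. of_bool (\<not> G t w)) + mean (\<lambda>w. of_bool (G t w) * (Y (T + t) w - Y T w)\<^sup>2)
    \<le> energy (T + t) - energy T"
proof (induction t)
  case 0
  have "G 0 w" for w using assms by (auto simp: G_def)
  then show ?case by (simp add: mean_const)
next
  case (Suc t)
  have adY: "s \<le> t' \<Longrightarrow> adapted t' (Y s)" for s t' by (rule adapted_mono[OF ad])
  have adG: "adapted (T + t) (G t)" for t
  proof (rule adaptedI)
    fix w w' :: "nat \<Rightarrow> 'b" assume eq: "\<And>s. 1 \<le> s \<Longrightarrow> s \<le> T + t \<Longrightarrow> w s = w' s"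
    have "Y s w = Y s w'" if "s \<le> T + t" for s by (rule adaptedD[OF adY[OF that] eq])
    then show "G t w = G t w'" by (auto simp: G_def)
  qed
  have adG': "adapted (Suc (T + t)) (G t)" "adapted (Suc (T + t)) (G (Suc t))"
    using adapted_mono[OF adG[of t], of "Suc (T + t)"] adG[of "Suc t"] by auto
  note ads = adapted_compose2[where h = "(*)"] adapted_compose2[where h = "(-)"] adapted_compose2[where h = "(+)"]
    adapted_compose[where h = "\<lambda>x. x\<^sup>2"] adapted_const adY adG adG'
    adapted_compose[where h = of_bool] adapted_compose[where h = Not]
  let ?Z = "\<lambda>t w. (Y (T + t) w - Y T w)\<^sup>2"
  let ?D = "\<lambda>w. Y (Suc (T + t)) w - Y (T + t) w"
  \<comment> \<open>The coefficient fed into \<open>energy_increment\<close>: the displacement,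
    switched off once the path has left the band.\<close>
  let ?g = "\<lambda>w. of_bool (G t w) * (Y (T + t) w - Y T w)"
  have G_Suc: "G (Suc t) w \<longleftrightarrow> G t w \<and> \<bar>Y (T + Suc t) w - Y T w\<bar> < \<epsilon>" for w
    by (auto simp: G_def le_Suc_eq)
  have sq: "\<epsilon>\<^sup>2 \<le> y\<^sup>2" if "\<not> \<bar>y\<bar> < \<epsilon>" for y :: real
    using that assms(1) abs_le_square_iff[of \<epsilon> y] by auto
  have "mean (\<lambda>w. \<epsilon>\<^sup>2 * of_bool (\<not> G (Suc t) w) + of_bool (G (Suc t) w) * ?Z (Suc t) w)
      \<le> mean (\<lambda>w. (\<epsilon>\<^sup>2 * of_bool (\<not> G t w) + of_bool (G t w) * ?Z t w) + (2 * ?g w * ?D w + (?D w)\<^sup>2))"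
  proof (rule mean_mono[where t = "Suc (T + t)"])
    fix w
    have Z: "?Z (Suc t) w = ?Z t w + 2 * (Y (T + t) w - Y T w) * ?D w + (?D w)\<^sup>2"
      by (simp add: power2_eq_square algebra_simps)
    show "\<epsilon>\<^sup>2 * of_bool (\<not> G (Suc t) w) + of_bool (G (Suc t) w) * ?Z (Suc t) w
      \<le> (\<epsilon>\<^sup>2 * of_bool (\<not> G t w) + of_bool (G t w) * ?Z t w) + (2 * ?g w * ?D w + (?D w)\<^sup>2)"
    \<comment> \<open>Inside the band, the right side is the expanded new square, which is at least
      \<epsilon> squared if the path leaves now. Outside, it only gains the square of the
      increment.\<close>
    proof (cases "G t w")
      case True
      then show ?thesis
        using sq[of "Y (T + Suc t) w - Y T w"] Z by (cases "G (Suc t) w") (auto simp: G_Suc)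
    next
      case False
      then show ?thesis by (simp add: G_Suc)
    qed
  qed (auto intro!: ads)
  also have "\<dots> = mean (\<lambda>w. \<epsilon>\<^sup>2 * of_bool (\<not> G t w) + of_bool (G t w) * ?Z t w) + mean (\<lambda>w. 2 * ?g w * ?D w + (?D w)\<^sup>2)"
    by (rule mean_add[of "Suc (T + t)"]) (auto intro!: ads)
  also have "mean (\<lambda>w. 2 * ?g w * ?D w + (?D w)\<^sup>2) \<le> energy (Suc (T + t)) - energy (T + t)"
  proof (rule energy_increment)
    show "adapted (T + t) ?g" by (auto intro!: ads)
    fix w assume "admissible w"
    then have "\<bar>Y (T + t) w - Y T w\<bar> \<le> 1" using bounds[of w "T + t"] bounds[of w T] by (auto simp: abs_le_iff)
    then show "\<bar>?g w\<bar> \<le> 1" by simp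
  qed
  also have "mean (\<lambda>w. \<epsilon>\<^sup>2 * of_bool (\<not> G t w) + of_bool (G t w) * ?Z t w)
      = \<epsilon>\<^sup>2 * mean (\<lambda>w. of_bool (\<not> G t w)) + mean (\<lambda>w. of_bool (G t w) * ?Z t w)"
    by (subst mean_add[of "T + t"]) (auto intro!: ads simp: mean_mult_left)
  also note Suc
  also have "mean (\<lambda>w. \<epsilon>\<^sup>2 * of_bool (\<not> G (Suc t) w) + of_bool (G (Suc t) w) * ?Z (Suc t) w)
      = \<epsilon>\<^sup>2 * mean (\<lambda>w. of_bool (\<not> G (Suc t) w)) + mean (\<lambda>w. of_bool (G (Suc t) w) * ?Z (Suc t) w)"
    by (subst mean_add[of "Suc (T + t)"]) (auto intro!: ads simp: mean_mult_left)
  finally show ?case by simp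
qed

text \<open>The events of leaving the band by time \<open>T + t\<close> increase with
  \<open>t\<close>; the maximal inequality bounds all of them uniformly.\<close>

lemma prob_oscillation_le:
  fixes T :: nat
  assumes "\<epsilon> > 0" "energy \<longlonglongrightarrow> E"
  defines "N \<equiv> {x\<in>space M. \<exists>t\<ge>T. \<bar>Y t (path x) - Y T (path x)\<bar> \<ge> \<epsilon>}"
  shows "N \<in> sets M" "prob N \<le> (E - energy T) / \<epsilon>\<^sup>2"
proof -
  have [measurable]: "(\<lambda>x. Y t (path x)) \<in> borel_measurable M" for t by (rule adapted_measurable[OF ad])
  show N: "N \<in> sets M" unfolding N_def by measurable
  define F where "F t = {x\<in>space M. \<exists>s\<in>{T..T + t}. \<bar>Y s (path x) - Y T (path x)\<bar> \<ge> \<epsilon>}" for t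
  have F: "F t \<in> sets M" for t unfolding F_def by measurable
  have F_le: "prob (F t) \<le> (E - energy T) / \<epsilon>\<^sup>2" for t
  proof -
    let ?G = "\<lambda>t w. \<forall>s\<in>{T..T + t}. \<bar>Y s w - Y T w\<bar> < \<epsilon>"
    have "prob (F t) = expectation (indicator (F t))" using F by simp
    also have "\<dots> = mean (\<lambda>w. of_bool (\<not> ?G t w))"
      unfolding mean_def by (intro Bochner_Integration.integral_cong) (auto simp: F_def indicator_def not_less)
    finally have eq: "prob (F t) = mean (\<lambda>w. of_bool (\<not> ?G t w))" .
    have "0 \<le> mean (\<lambda>w. of_bool (?G t w) * (Y (T + t) w - Y T w)\<^sup>2)"
      unfolding mean_def by (intro integral_nonneg_AE) auto
    with maximal_inequality[OF assms(1), of T t] have "\<epsilon>\<^sup>2 * prob (F t) \<le> energy (T + t) - energy T"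
      unfolding eq by linarith
    also have "energy (T + t) \<le> E" by (rule incseq_le[OF energy_mono assms(2)])
    finally show ?thesis using assms(1) by (simp add: field_simps)
  qed
  have "incseq F" by (rule incseq_SucI) (fastforce simp: F_def)
  then have "(\<lambda>t. prob (F t)) \<longlonglongrightarrow> prob (\<Union>t. F t)"
    using F by (intro finite_Lim_measure_incseq) auto
  moreover have "(\<Union>t. F t) = N"
  proof (intro equalityI subsetI)
    fix x assume "x \<in> N"
    then obtain t where "x \<in> space M" "t \<ge> T" "\<bar>Y t (path x) - Y T (path x)\<bar> \<ge> \<epsilon>" by (auto simp: N_def)
    then have "x \<in> F (t - T)" by (auto simp: F_def)
    then show "x \<in> (\<Union>t. F t)" by auto
  qed (auto simp: F_def N_def)
  ultimately show "prob N \<le> (E - energy T) / \<epsilon>\<^sup>2" using F_le by (intro LIMSEQ_le_const2) auto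
qed

text \<open>The energy is increasing and bounded, so the remaining energy after \<open>T\<close>
  tends to 0 and with it the probability of an \<epsilon>-oscillation after \<open>T\<close>. Taking
  \<epsilon> along \<open>1 / (k + 1)\<close> makes almost every path Cauchy.\<close>

lemma bounded_submartingale_convergent: "AE x in M. convergent (\<lambda>t. Y t (path x))"
proof -
  obtain E where E: "energy \<longlonglongrightarrow> E"
    using incseq_convergent[OF energy_mono, of 3] energy_le by blast
  have "AE x in M. \<exists>T. \<forall>t\<ge>T. \<bar>Y t (path x) - Y T (path x)\<bar> < \<epsilon>" if \<epsilon>: "\<epsilon> > 0" for \<epsilon>
  proof -
    define N where "N T = {x\<in>space M. \<exists>t\<ge>T. \<bar>Y t (path x) - Y T (path x)\<bar> \<ge> \<epsilon>}" for T
    note N = prob_oscillation_le[OF \<epsilon> E, folded N_def]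
    have "(\<lambda>T. (E - energy T) / \<epsilon>\<^sup>2) \<longlonglongrightarrow> (E - E) / \<epsilon>\<^sup>2"
      using \<epsilon> by (intro tendsto_intros E) auto
    moreover have "prob (\<Inter>T. N T) \<le> (E - energy T) / \<epsilon>\<^sup>2" for T
      using finite_measure_mono[of "\<Inter>T. N T" "N T"] N by (meson INT_lower UNIV_I order_trans)
    ultimately have "prob (\<Inter>T. N T) \<le> 0"
      by (intro LIMSEQ_le_const[where X = "\<lambda>T. (E - energy T) / \<epsilon>\<^sup>2"]) auto
    then have "prob (\<Inter>T. N T) = 0" by (simp add: measure_le_0_iff)
    moreover have "(\<Inter>T. N T) \<in> sets M" using N(1) by auto
    ultimately have "AE x in M. x \<notin> (\<Inter>T. N T)" by (simp add: prob_eq_0)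
    moreover have "AE x in M. x \<in> space M" by simp
    ultimately show ?thesis
    proof eventually_elim
      case (elim x)
      then obtain T where "x \<notin> N T" by blast
      then have "\<not> \<epsilon> \<le> \<bar>Y t (path x) - Y T (path x)\<bar>" if "t \<ge> T" for t
        using elim(2) that unfolding N_def by blast
      then show ?case unfolding not_le by blast
    qed
  qed
  then have "AE x in M. \<forall>k. \<exists>T. \<forall>t\<ge>T. \<bar>Y t (path x) - Y T (path x)\<bar> < inverse (real (Suc k))"
    by (simp add: AE_all_countable)
  then show ?thesis
  proof eventually_elim
    case (elim x)
    show ?case
    proof (rule Cauchy_convergent, rule metric_CauchyI)
      fix e :: real assume "e > 0"
      then obtain k where k: "inverse (real (Suc k)) < e / 2" using reals_Archimedean[of "e / 2"] by auto
      from elim obtain T where "\<And>t. t \<ge> T \<Longrightarrow> \<bar>Y t (path x) - Y T (path x)\<bar> < inverse (real (Suc k))" by blast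
      then have T: "\<bar>Y t (path x) - Y T (path x)\<bar> < e / 2" if "t \<ge> T" for t
        using that k by (meson less_trans)
      have "dist (Y m (path x)) (Y n (path x)) < e" if "m \<ge> T" "n \<ge> T" for m n
        using T[OF that(1)] T[OF that(2)] unfolding dist_real_def by arith
      then show "\<exists>T. \<forall>m\<ge>T. \<forall>n\<ge>T. dist (Y m (path x)) (Y n (path x)) < e" by blast
    qed
  qed
qed

end

end

section \<open>Beliefs and predictions\<close>

text \<open>Passing to square roots, as for the Hellinger distance, \<open>ln x \<le> x - 1\<close>
  at \<open>sqrt (m / q)\<close> yields the term \<open>(sqrt q - sqrt m)\<^sup>2\<close>. The
  linear term \<open>q - m\<close> cancels when summed over two laws of equal mass.\<close>

lemma relative_entropy_term_lower_bound:
  fixes q m :: real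
  assumes "0 < q" "q \<le> 1" "0 < m" "m \<le> 1"
  shows "q * ln (q / m) \<ge> (q - m)\<^sup>2 / 4 + (q - m)"
proof -
  define a b where "a = sqrt q" and "b = sqrt m"
  have ab: "0 < a" "a \<le> 1" "0 < b" "b \<le> 1" "q = a\<^sup>2" "m = b\<^sup>2" using assms by (auto simp: a_def b_def)
  have "(q - m)\<^sup>2 = (a - b)\<^sup>2 * (a + b)\<^sup>2" unfolding ab by (simp add: power2_eq_square algebra_simps)
  also have "\<dots> \<le> (a - b)\<^sup>2 * 2\<^sup>2" using ab by (intro mult_left_mono power_mono) auto
  finally have sq: "(q - m)\<^sup>2 / 4 \<le> (a - b)\<^sup>2" by simp
  have "ln (b / a) \<le> b / a - 1" using ab by (intro ln_le_minus_one) auto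
  moreover have "ln (q / m) = - 2 * ln (b / a)"
    unfolding ab using ab by (simp add: ln_div ln_realpow)
  ultimately have "ln (q / m) \<ge> 2 - 2 * (b / a)" by simp
  then have "q * ln (q / m) \<ge> q * (2 - 2 * (b / a))" using assms by (intro mult_left_mono) auto
  moreover have "q * (2 - 2 * (b / a)) = (a - b)\<^sup>2 + (q - m)"
    unfolding ab using ab by (simp add: power2_eq_square field_simps)
  ultimately show ?thesis using sq by linarith
qed

lemma relative_entropy_lower_bound:
  fixes q m :: "'a \<Rightarrow> real"
  assumes "\<And>s. s \<in> I \<Longrightarrow> 0 < q s \<and> q s \<le> 1 \<and> 0 < m s \<and> m s \<le> 1" "sum q I = sum m I"
  shows "(\<Sum>s\<in>I. q s * ln (q s / m s)) \<ge> (\<Sum>s\<in>I. (q s - m s)\<^sup>2) / 4"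
proof -
  have "(\<Sum>s\<in>I. (q s - m s)\<^sup>2) / 4 = (\<Sum>s\<in>I. (q s - m s)\<^sup>2 / 4 + (q s - m s))"
    using assms(2) by (simp add: sum.distrib sum_subtractf sum_divide_distrib)
  also have "\<dots> \<le> (\<Sum>s\<in>I. q s * ln (q s / m s))"
    using assms(1) by (intro sum_mono relative_entropy_term_lower_bound) auto
  finally show ?thesis .
qed

text \<open>The sum is the chi-square divergence of \<open>q\<close> from \<open>m\<close>, once the
  linear terms cancel.\<close>

lemma chi_square_nonneg:
  fixes q m :: "'a \<Rightarrow> real"
  assumes "\<And>s. s \<in> I \<Longrightarrow> 0 < m s" "sum q I = sum m I"
  shows "(\<Sum>s\<in>I. q s * (q s / m s - 1)) \<ge> 0"
proof -
  have "(\<Sum>s\<in>I. q s * (q s / m s - 1)) = (\<Sum>s\<in>I. (q s - m s)\<^sup>2 / m s + (q s - m s))"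
  proof (intro sum.cong refl)
    fix s assume "s \<in> I"
    then have "m s \<noteq> 0" using assms(1) by force
    then show "q s * (q s / m s - 1) = (q s - m s)\<^sup>2 / m s + (q s - m s)"
      by (simp add: field_simps power2_eq_square)
  qed
  also have "\<dots> = (\<Sum>s\<in>I. (q s - m s)\<^sup>2 / m s)"
    using assms(2) by (simp add: sum.distrib sum_subtractf)
  also have "\<dots> \<ge> 0" using assms(1) by (intro sum_nonneg divide_nonneg_pos) auto
  finally show ?thesis .
qed

locale learning = usc_chain A \<delta> B + iid_process M \<omega> "l \<theta>s" "Pi UNIV S"
  for A :: "nat \<Rightarrow> real^'n::finite^'n" and \<delta> B
    and M :: "'w measure" and \<omega> :: "nat \<Rightarrow> 'w \<Rightarrow> 'n \<Rightarrow> 'sig"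
    and l :: "'state::finite \<Rightarrow> ('n \<Rightarrow> 'sig) pmf" and \<theta>s :: 'state
    and S :: "'n \<Rightarrow> 'sig set" +
  fixes \<mu>0 :: "'n \<Rightarrow> 'state pmf" and j0 :: 'n
  assumes finite_S: "finite (S i)"
    and set_l: "set_pmf (l \<theta>) \<subseteq> Pi UNIV S"
    and lik_pos: "s \<in> S i \<Longrightarrow> marginal_likelihood l i s \<theta> > 0"
    and prior_pos: "pmf (\<mu>0 j0) \<theta>s > 0"
begin

section \<open>Bounds on predictions and beliefs\<close>

abbreviation lik :: "'n \<Rightarrow> 'sig \<Rightarrow> 'state \<Rightarrow> real" where
  "lik \<equiv> marginal_likelihood l"

abbreviation \<mu> :: "(nat \<Rightarrow> 'n \<Rightarrow> 'sig) \<Rightarrow> nat \<Rightarrow> 'state \<Rightarrow> real^'n" where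
  "\<mu> \<equiv> belief A l \<mu>0"

definition predictive :: "(nat \<Rightarrow> 'n \<Rightarrow> 'sig) \<Rightarrow> nat \<Rightarrow> 'n \<Rightarrow> 'sig \<Rightarrow> real" where
  "predictive w t i s = (\<Sum>\<theta>\<in>UNIV. lik i s \<theta> * \<mu> w t \<theta> $ i)"

text \<open>The next belief as a function of a hypothetical signal \<open>s\<close>, split into the
  averaging step and the Bayesian correction. Keeping \<open>s\<close> free allows averaging over
  signals that did not occur.\<close>

definition bayes_step :: "(nat \<Rightarrow> 'n \<Rightarrow> 'sig) \<Rightarrow> nat \<Rightarrow> 'n \<Rightarrow> 'state \<Rightarrow> 'sig \<Rightarrow> real" where
  "bayes_step w t i \<theta> s = (\<Sum>j\<in>UNIV. A t $ i $ j * \<mu> w t \<theta> $ j)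
     + A t $ i $ i * \<mu> w t \<theta> $ i * (lik i s \<theta> / predictive w t i s - 1)"

lemma lik_le_1: "lik i s \<theta> \<le> 1"
  by (simp add: marginal_likelihood_def pmf_le_1)

lemma lik_nonneg: "lik i s \<theta> \<ge> 0"
  by (simp add: marginal_likelihood_def)

lemma lik_sum: "(\<Sum>s\<in>S i. lik i s \<theta>) = 1"
  unfolding marginal_likelihood_def using set_l[of \<theta>] by (intro sum_pmf_eq_1 finite_S) auto

lemma sum_marginal:
  "(\<Sum>a\<in>Pi UNIV S. pmf (l \<theta>s) a * g (a i)) = (\<Sum>s\<in>S i. lik i s \<theta>s * g s)" for g :: "'sig \<Rightarrow> real"
proof -
  have "(\<Sum>a\<in>Pi UNIV S. g (a i) * pmf (l \<theta>s) a) = measure_pmf.expectation (l \<theta>s) (\<lambda>a. g (a i))"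
    using set_p by (intro integral_measure_pmf_real[symmetric] finite_\<Omega>) auto
  also have "\<dots> = measure_pmf.expectation (map_pmf (\<lambda>a. a i) (l \<theta>s)) g" by simp
  also have "\<dots> = (\<Sum>s\<in>S i. g s * lik i s \<theta>s)"
    unfolding marginal_likelihood_def using set_p by (intro integral_measure_pmf_real finite_S) auto
  finally show ?thesis by (simp add: mult.commute)
qed

lemma lik_lower_bound: "\<exists>c>0. c \<le> 1 \<and> (\<forall>i. \<forall>s\<in>S i. \<forall>\<theta>. c \<le> lik i s \<theta>)"
proof -
  \<comment> \<open>Inserting 1 makes the minimum at most 1.\<close>
  define V where "V = insert 1 ((\<lambda>(i, s, \<theta>). lik i s \<theta>) ` (SIGMA i:UNIV. S i \<times> UNIV))"
  have fin: "finite V" unfolding V_def by (intro finite.insertI finite_imageI finite_SigmaI finite_S) auto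
  have "Min V \<in> V" by (rule Min_in[OF fin]) (auto simp: V_def)
  then have "Min V > 0" by (auto simp: V_def lik_pos)
  moreover have "Min V \<le> 1" using fin by (intro Min_le) (auto simp: V_def)
  moreover have "Min V \<le> lik i s \<theta>" if "s \<in> S i" for i s \<theta>
    using fin that by (intro Min_le) (auto simp: V_def intro!: image_eqI[of _ _ "(i, s, \<theta>)"])
  ultimately show ?thesis by blast
qed

definition lmin :: real where
  "lmin = (SOME c. c > 0 \<and> c \<le> 1 \<and> (\<forall>i. \<forall>s\<in>S i. \<forall>\<theta>. c \<le> lik i s \<theta>))"

lemma lmin: "lmin > 0" "lmin \<le> 1" "s \<in> S i \<Longrightarrow> lmin \<le> lik i s \<theta>"
  using someI_ex[OF lik_lower_bound] unfolding lmin_def[symmetric] by auto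

text \<open>The simplex properties appear as assumptions because this bound is needed inside the
  induction that proves them.\<close>

lemma predictive_bounds_aux:
  assumes "\<And>\<theta>. 0 \<le> \<mu> w t \<theta> $ i" "(\<Sum>\<theta>\<in>UNIV. \<mu> w t \<theta> $ i) = 1" "s \<in> S i"
  shows "lmin \<le> predictive w t i s" "predictive w t i s \<le> 1"
proof -
  have "(\<Sum>\<theta>\<in>UNIV. lmin * \<mu> w t \<theta> $ i) \<le> predictive w t i s"
    unfolding predictive_def using assms by (intro sum_mono mult_right_mono lmin) auto
  then show "lmin \<le> predictive w t i s" using assms(2) by (simp add: sum_distrib_left[symmetric])
  have "predictive w t i s \<le> (\<Sum>\<theta>\<in>UNIV. 1 * \<mu> w t \<theta> $ i)"
    unfolding predictive_def using assms by (intro sum_mono mult_right_mono lik_le_1) auto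
  then show "predictive w t i s \<le> 1" using assms(2) by simp
qed

lemma bayes_step_eq:
  "bayes_step w t i \<theta> s = A t $ i $ i * (lik i s \<theta> * \<mu> w t \<theta> $ i / predictive w t i s)
     + (\<Sum>j\<in>UNIV - {i}. A t $ i $ j * \<mu> w t \<theta> $ j)"
proof -
  have "(\<Sum>j\<in>UNIV. A t $ i $ j * \<mu> w t \<theta> $ j)
      = A t $ i $ i * \<mu> w t \<theta> $ i + (\<Sum>j\<in>UNIV - {i}. A t $ i $ j * \<mu> w t \<theta> $ j)"
    by (rule sum.remove) auto
  then show ?thesis by (simp add: bayes_step_def algebra_simps)
qed

lemma belief_Suc: "\<mu> w (Suc t) \<theta> $ i = bayes_step w t i \<theta> (w (Suc t) i)"
  by (simp add: bayes_step_eq predictive_def)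

lemma sum_bayes_step:
  assumes "predictive w t i s \<noteq> 0"
    and "\<And>j. (\<Sum>\<theta>\<in>UNIV. \<mu> w t \<theta> $ j) = 1"
  shows "(\<Sum>\<theta>\<in>UNIV. bayes_step w t i \<theta> s) = 1"
proof -
  have "bayes_step w t i \<theta> s = (\<Sum>j\<in>UNIV. A t $ i $ j * \<mu> w t \<theta> $ j)
      + (A t $ i $ i / predictive w t i s * (lik i s \<theta> * \<mu> w t \<theta> $ i) - A t $ i $ i * \<mu> w t \<theta> $ i)" for \<theta>
    by (simp add: bayes_step_def right_diff_distrib)
  then have "(\<Sum>\<theta>\<in>UNIV. bayes_step w t i \<theta> s)
      = (\<Sum>\<theta>\<in>UNIV. \<Sum>j\<in>UNIV. A t $ i $ j * \<mu> w t \<theta> $ j)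
        + (A t $ i $ i / predictive w t i s * predictive w t i s - A t $ i $ i * (\<Sum>\<theta>\<in>UNIV. \<mu> w t \<theta> $ i))"
    by (simp only: sum.distrib sum_subtractf sum_distrib_left[symmetric] predictive_def)
  also have "(\<Sum>\<theta>\<in>UNIV. \<Sum>j\<in>UNIV. A t $ i $ j * \<mu> w t \<theta> $ j) = (\<Sum>j\<in>UNIV. A t $ i $ j * (\<Sum>\<theta>\<in>UNIV. \<mu> w t \<theta> $ j))"
    by (subst sum.swap) (simp add: sum_distrib_left)
  also have "\<dots> = 1" using assms by (simp add: A_row_sum)
  finally show ?thesis using assms by simp
qed

lemma belief_simplex:
  assumes "admissible w"
  shows "(\<forall>\<theta>. 0 \<le> \<mu> w t \<theta> $ i) \<and> (\<Sum>\<theta>\<in>UNIV. \<mu> w t \<theta> $ i) = 1"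
proof (induction t arbitrary: i)
  case 0
  then show ?case by (simp add: sum_pmf_eq_1)
next
  case (Suc t)
  have s: "w (Suc t) i \<in> S i" using assms by (auto simp: admissible_def)
  have pr: "predictive w t i (w (Suc t) i) \<ge> lmin" using Suc s by (intro predictive_bounds_aux) auto
  then have "predictive w t i (w (Suc t) i) > 0" using lmin(1) by linarith
  then show ?case
    using Suc sum_bayes_step[of w t i "w (Suc t) i"]
    by (auto simp: belief_Suc bayes_step_eq A_nonneg lik_nonneg simp del: belief.simps intro!: add_nonneg_nonneg sum_nonneg)
qed

lemma belief_nonneg: "admissible w \<Longrightarrow> 0 \<le> \<mu> w t \<theta> $ i"
  and belief_sum: "admissible w \<Longrightarrow> (\<Sum>\<theta>\<in>UNIV. \<mu> w t \<theta> $ i) = 1"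
  using belief_simplex by auto

lemma belief_le_1:
  assumes "admissible w" shows "\<mu> w t \<theta> $ i \<le> 1"
  using member_le_sum[of \<theta> UNIV "\<lambda>\<theta>. \<mu> w t \<theta> $ i"] belief_simplex[OF assms, of t i] by auto

lemma predictive_bounds:
  assumes "admissible w" "s \<in> S i"
  shows "lmin \<le> predictive w t i s" "predictive w t i s \<le> 1" "0 < predictive w t i s"
  using predictive_bounds_aux[of w t i s] belief_simplex[OF assms(1)] assms(2) lmin(1) by (auto intro: less_le_trans)

lemma predictive_sum:
  assumes "admissible w" shows "(\<Sum>s\<in>S i. predictive w t i s) = 1"
  unfolding predictive_def
  by (subst sum.swap) (simp add: sum_distrib_right[symmetric] lik_sum belief_sum[OF assms])

text \<open>A neighbour's belief enters with weight at least \<delta>; the agent's own belief is in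
  addition multiplied by a likelihood of at least \<open>lmin\<close> over a prediction of at most
  1.\<close>

lemma belief_step_lower_bound:
  assumes w: "admissible w" and pos: "A t $ i $ j > 0"
  shows "\<mu> w (Suc t) \<theta> $ i \<ge> (\<delta> * lmin) * \<mu> w t \<theta> $ j"
proof -
  let ?s = "w (Suc t) i"
  have s: "?s \<in> S i" using w by (auto simp: admissible_def)
  have nn: "0 \<le> (\<Sum>j\<in>UNIV - {i}. A t $ i $ j * \<mu> w t \<theta> $ j)"
    by (intro sum_nonneg mult_nonneg_nonneg A_nonneg belief_nonneg w)
  have nn': "0 \<le> A t $ i $ i * (lik i ?s \<theta> * \<mu> w t \<theta> $ i / predictive w t i ?s)"
    using predictive_bounds(3)[OF w s, of t]
    by (intro mult_nonneg_nonneg divide_nonneg_nonneg A_nonneg belief_nonneg w lik_nonneg) simp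
  show ?thesis
  proof (cases "j = i")
    case True
    have "lmin * \<mu> w t \<theta> $ i \<le> lik i ?s \<theta> * \<mu> w t \<theta> $ i / 1"
      using lmin(3)[OF s] belief_nonneg[OF w] by (simp add: mult_right_mono)
    also have "\<dots> \<le> lik i ?s \<theta> * \<mu> w t \<theta> $ i / predictive w t i ?s"
      using predictive_bounds[OF w s] by (intro divide_left_mono mult_nonneg_nonneg lik_nonneg belief_nonneg w) auto
    finally have "\<delta> * (lmin * \<mu> w t \<theta> $ i) \<le> A t $ i $ i * (lik i ?s \<theta> * \<mu> w t \<theta> $ i / predictive w t i ?s)"
      using \<delta>_pos lmin(1) belief_nonneg[OF w] \<delta>_le[OF diag_pos] by (intro mult_mono) (auto simp: A_nonneg intro: mult_nonneg_nonneg)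
    then show ?thesis using nn True unfolding belief_Suc bayes_step_eq by (simp add: mult.assoc)
  next
    case False
    have "\<delta> * lmin \<le> \<delta> * 1" using \<delta>_pos lmin by (intro mult_left_mono) auto
    then have "(\<delta> * lmin) * \<mu> w t \<theta> $ j \<le> A t $ i $ j * \<mu> w t \<theta> $ j"
      using \<delta>_le[OF pos] belief_nonneg[OF w] by (intro mult_right_mono) auto
    also have "\<dots> \<le> (\<Sum>j\<in>UNIV - {i}. A t $ i $ j * \<mu> w t \<theta> $ j)"
      using False by (intro member_le_sum mult_nonneg_nonneg A_nonneg belief_nonneg w) auto
    finally show ?thesis using nn' unfolding belief_Suc bayes_step_eq by simp
  qed
qed

lemma belief_window_lower_bound:
  assumes "admissible w"
  shows "\<mu> w (t + window) \<theta> $ i \<ge> (\<delta> * lmin) ^ window * \<mu> w t \<theta> $ j"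
  using window_lower_bound[of "\<delta> * lmin" t "\<lambda>k i. \<mu> w (t + k) \<theta> $ i"]
    belief_step_lower_bound[OF assms] \<delta>_pos lmin(1) by simp

lemma adapted_belief: "adapted t (\<lambda>w. \<mu> w t)"
proof -
  have eq: "\<mu> w t \<theta> = \<mu> w' t \<theta>" if "\<And>s. 1 \<le> s \<Longrightarrow> s \<le> t \<Longrightarrow> w s = w' s" for w w' \<theta>
    using that
  proof (induction t arbitrary: \<theta>)
    case (Suc t)
    have "\<mu> w t \<theta> = \<mu> w' t \<theta>" for \<theta> by (rule Suc.IH) (simp add: Suc.prems)
    moreover have "w (Suc t) = w' (Suc t)" by (rule Suc.prems) auto
    ultimately show ?case by simp
  qed simp
  show ?thesis by (rule adaptedI, rule ext, rule eq)
qed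

lemma adapted_predictive: "adapted t (\<lambda>w. predictive w t i s)"
  unfolding predictive_def
  by (rule adapted_compose[OF adapted_belief, of t "\<lambda>b. \<Sum>\<theta>\<in>UNIV. lik i s \<theta> * b \<theta> $ i"])

lemma adapted_bayes_step: "adapted t (\<lambda>w. bayes_step w t i \<theta> s)"
  unfolding bayes_step_def
  by (rule adapted_compose2[where h = "\<lambda>b m. (\<Sum>j\<in>UNIV. A t $ i $ j * b \<theta> $ j)
     + A t $ i $ i * b \<theta> $ i * (lik i s \<theta> / m - 1)", OF adapted_belief adapted_predictive])

lemma belief_upd: "\<mu> (w(Suc t := a)) (Suc t) \<theta> $ i = bayes_step w t i \<theta> (a i)"
  by (simp only: belief_Suc fun_upd_same adapted_upd[OF adapted_bayes_step])

end

section \<open>The logarithmic potential\<close>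

context learning
begin

text \<open>One window carries the positive prior of \<open>j0\<close> to everybody; afterwards each
  agent's own weight keeps the belief positive.\<close>

lemma belief_true_pos:
  assumes w: "admissible w" and t: "t \<ge> window"
  shows "\<mu> w t \<theta>s $ i > 0"
  using t
proof (induction t arbitrary: i rule: dec_induct)
  case base
  have "0 < (\<delta> * lmin) ^ window * \<mu> w 0 \<theta>s $ j0" using \<delta>_pos lmin(1) prior_pos by simp
  also have "\<dots> \<le> \<mu> w window \<theta>s $ i" using belief_window_lower_bound[OF w, where t = 0 and \<theta> = \<theta>s and j = j0 and i = i] by simp
  finally show ?case .
next
  case (step t)
  have "0 < \<delta> * lmin * \<mu> w t \<theta>s $ i" using \<delta>_pos lmin(1) step.IH by simp
  also have "\<dots> \<le> \<mu> w (Suc t) \<theta>s $ i" by (rule belief_step_lower_bound[OF w diag_pos])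
  finally show ?case .
qed

text \<open>Some priors may vanish at \<open>\<theta>s\<close>, so the potential is meaningful (\<open>ln 0 = 0\<close>) only from
  time \<open>window\<close> on, when the positive prior of \<open>j0\<close> has reached every agent.\<close>

definition potential :: "nat \<Rightarrow> (nat \<Rightarrow> 'n \<Rightarrow> 'sig) \<Rightarrow> real" where
  "potential t w = (\<Sum>i\<in>UNIV. abs_prob t $ i * ln (\<mu> w t \<theta>s $ i))"

definition deviation :: "nat \<Rightarrow> (nat \<Rightarrow> 'n \<Rightarrow> 'sig) \<Rightarrow> real" where
  "deviation t w = (\<Sum>i\<in>UNIV. \<Sum>s\<in>S i. (lik i s \<theta>s - predictive w t i s)\<^sup>2)"

lemma adapted_potential: "adapted t (potential t)"
  unfolding potential_def
  by (rule adapted_compose[where h = "\<lambda>b. \<Sum>i\<in>UNIV. abs_prob t $ i * ln (b \<theta>s $ i)", OF adapted_belief])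

lemma adapted_deviation: "adapted t (deviation t)"
  unfolding deviation_def
  by (intro adapted_sum adapted_compose[where h = "\<lambda>m. (lik i s \<theta>s - m)\<^sup>2" for i s] adapted_predictive)

lemma deviation_nonneg: "deviation t w \<ge> 0"
  unfolding deviation_def by (intro sum_nonneg) auto

text \<open>Jensen's inequality for the concave logarithm, with row \<open>i\<close> of the matrix
  as weights. The points \<open>z\<close> are the neighbours' beliefs and, at \<open>i\<close>, the
  agent's own Bayesian posterior.\<close>

lemma ln_bayes_step:
  assumes w: "admissible w" and t: "t \<ge> window" and s: "s \<in> S i"
  shows "ln (bayes_step w t i \<theta>s s) \<ge>
    (\<Sum>j\<in>UNIV. A t $ i $ j * ln (\<mu> w t \<theta>s $ j)) + A t $ i $ i * ln (lik i s \<theta>s / predictive w t i s)"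
proof -
  define z where "z j = (if j = i then lik i s \<theta>s * \<mu> w t \<theta>s $ i / predictive w t i s else \<mu> w t \<theta>s $ j)" for j
  have pr: "predictive w t i s > 0" by (rule predictive_bounds(3)[OF w s])
  have z: "z j > 0" for j using belief_true_pos[OF w t] pr lik_pos[OF s] by (auto simp: z_def)
  have split: "(\<Sum>j\<in>UNIV. A t $ i $ j * f j) = A t $ i $ i * f i + (\<Sum>j\<in>UNIV - {i}. A t $ i $ j * f j)" for f
    by (rule sum.remove) auto
  have "(\<Sum>j\<in>UNIV. A t $ i $ j * ln (z j)) = A t $ i $ i * ln (z i) + (\<Sum>j\<in>UNIV - {i}. A t $ i $ j * ln (\<mu> w t \<theta>s $ j))"
    unfolding split[of "\<lambda>j. ln (z j)"] by (simp add: z_def)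
  also have "ln (z i) = ln (lik i s \<theta>s / predictive w t i s) + ln (\<mu> w t \<theta>s $ i)"
    using pr lik_pos[OF s, of \<theta>s] belief_true_pos[OF w t, of i] by (simp add: z_def ln_mult ln_div)
  also have "A t $ i $ i * (ln (lik i s \<theta>s / predictive w t i s) + ln (\<mu> w t \<theta>s $ i))
      + (\<Sum>j\<in>UNIV - {i}. A t $ i $ j * ln (\<mu> w t \<theta>s $ j))
      = (\<Sum>j\<in>UNIV. A t $ i $ j * ln (\<mu> w t \<theta>s $ j)) + A t $ i $ i * ln (lik i s \<theta>s / predictive w t i s)"
    unfolding split[of "\<lambda>j. ln (\<mu> w t \<theta>s $ j)"] by (simp add: distrib_left)
  finally have eq: "(\<Sum>j\<in>UNIV. A t $ i $ j * ln (z j)) = \<dots>" .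
  have "bayes_step w t i \<theta>s s = (\<Sum>j\<in>UNIV. A t $ i $ j * z j)"
    unfolding bayes_step_eq split[of z] by (simp add: z_def)
  moreover have "(\<Sum>j\<in>UNIV. A t $ i $ j * ln (z j)) \<le> ln (\<Sum>j\<in>UNIV. A t $ i $ j *\<^sub>R z j)"
    by (rule concave_on_sum[OF _ _ ln_concave]) (auto simp: A_row_sum A_nonneg z)
  ultimately show ?thesis using eq by simp
qed

text \<open>Collects the lower bounds on the absolute probabilities and on the diagonal, and the
  factor 1/4 of the relative entropy bound.\<close>

definition gain :: real where "gain = \<delta> ^ window * \<delta> / 4"

lemma gain_pos: "gain > 0"
  using \<delta>_pos by (simp add: gain_def)

text \<open>Averaged over the next signal, the neighbours' logarithms give back the potential by
  invariance, and the agent's own log-ratio becomes a relative entropy, which dominates the squared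
  deviation.\<close>

lemma potential_drift:
  assumes w: "admissible w" and t: "t \<ge> window"
  shows "cexp t (potential (Suc t)) w \<ge> potential t w + gain * deviation t w"
proof -
  let ?KL = "\<lambda>i. \<Sum>s\<in>S i. lik i s \<theta>s * ln (lik i s \<theta>s / predictive w t i s)"
  let ?Q = "\<lambda>i. \<Sum>j\<in>UNIV. A t $ i $ j * ln (\<mu> w t \<theta>s $ j)"
  have affine: "(\<Sum>s\<in>I. q s * (Q + c * f s)) = (\<Sum>s\<in>I. q s) * Q + c * (\<Sum>s\<in>I. q s * f s)"
    for I :: "'sig set" and q f :: "'sig \<Rightarrow> real" and Q c
    unfolding sum_distrib_left[of c] sum_distrib_right sum.distrib[symmetric] by (simp add: algebra_simps)
  have swap: "(\<Sum>a\<in>I. q a * (\<Sum>i\<in>UNIV. v $ i * g a i)) = (\<Sum>i\<in>UNIV. v $ i * (\<Sum>a\<in>I. q a * g a i))"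
    for I :: "('n \<Rightarrow> 'sig) set" and q :: "('n \<Rightarrow> 'sig) \<Rightarrow> real" and v :: "real^'n" and g
    unfolding sum_distrib_left by (subst sum.swap) (simp add: mult.left_commute)
  have upd: "potential (Suc t) (w(Suc t := a)) \<ge> (\<Sum>i\<in>UNIV. abs_prob (Suc t) $ i *
      (?Q i + A t $ i $ i * ln (lik i (a i) \<theta>s / predictive w t i (a i))))" if a: "a \<in> Pi UNIV S" for a
    unfolding potential_def belief_upd
    using a by (intro sum_mono mult_left_mono ln_bayes_step w t abs_prob_nonneg) auto
  have "(\<Sum>a\<in>Pi UNIV S. pmf (l \<theta>s) a * (\<Sum>i\<in>UNIV. abs_prob (Suc t) $ i *
      (?Q i + A t $ i $ i * ln (lik i (a i) \<theta>s / predictive w t i (a i))))) \<le> cexp t (potential (Suc t)) w"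
    unfolding cexp_def by (intro sum_mono mult_left_mono upd) auto
  also have "(\<Sum>a\<in>Pi UNIV S. pmf (l \<theta>s) a * (\<Sum>i\<in>UNIV. abs_prob (Suc t) $ i *
      (?Q i + A t $ i $ i * ln (lik i (a i) \<theta>s / predictive w t i (a i)))))
      = (\<Sum>i\<in>UNIV. abs_prob (Suc t) $ i * (\<Sum>a\<in>Pi UNIV S. pmf (l \<theta>s) a *
          (?Q i + A t $ i $ i * ln (lik i (a i) \<theta>s / predictive w t i (a i)))))"
    by (rule swap)
  also have "\<dots> = (\<Sum>i\<in>UNIV. abs_prob (Suc t) $ i * (?Q i + A t $ i $ i * ?KL i))"
  proof (intro sum.cong refl arg_cong2[where f = "(*)"])
    fix i
    have "(\<Sum>a\<in>Pi UNIV S. pmf (l \<theta>s) a * (?Q i + A t $ i $ i * ln (lik i (a i) \<theta>s / predictive w t i (a i))))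
        = (\<Sum>s\<in>S i. lik i s \<theta>s * (?Q i + A t $ i $ i * ln (lik i s \<theta>s / predictive w t i s)))"
      by (rule sum_marginal)
    also have "\<dots> = (\<Sum>s\<in>S i. lik i s \<theta>s) * ?Q i + A t $ i $ i * ?KL i"
      by (rule affine)
    finally show "(\<Sum>a\<in>Pi UNIV S. pmf (l \<theta>s) a * (?Q i + A t $ i $ i * ln (lik i (a i) \<theta>s / predictive w t i (a i))))
        = ?Q i + A t $ i $ i * ?KL i" by (simp add: lik_sum)
  qed
  also have "\<dots> = potential t w + (\<Sum>i\<in>UNIV. abs_prob (Suc t) $ i * (A t $ i $ i * ?KL i))"
    unfolding potential_def abs_prob_average[of t, symmetric] by (simp only: distrib_left sum.distrib)
  finally have "potential t w + (\<Sum>i\<in>UNIV. abs_prob (Suc t) $ i * (A t $ i $ i * ?KL i)) \<le> cexp t (potential (Suc t)) w" .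
  moreover have "gain * deviation t w \<le> (\<Sum>i\<in>UNIV. abs_prob (Suc t) $ i * (A t $ i $ i * ?KL i))"
    unfolding deviation_def
  proof (subst sum_distrib_left, rule sum_mono)
    fix i
    let ?D = "\<Sum>s\<in>S i. (lik i s \<theta>s - predictive w t i s)\<^sup>2"
    have D: "0 \<le> ?D" by (intro sum_nonneg) auto
    have KL: "?D / 4 \<le> ?KL i"
      using predictive_bounds[OF w] lik_pos lik_le_1
      by (intro relative_entropy_lower_bound) (auto simp: lik_sum predictive_sum[OF w])
    have "\<delta> ^ window * (\<delta> * (?D / 4)) \<le> abs_prob (Suc t) $ i * (A t $ i $ i * ?KL i)"
      using \<delta>_pos D KL
      by (intro mult_mono abs_prob_lower_bound \<delta>_le[OF diag_pos] KL A_nonneg abs_prob_nonneg mult_nonneg_nonneg) auto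
    then show "gain * ?D \<le> abs_prob (Suc t) $ i * (A t $ i $ i * ?KL i)" by (simp add: gain_def)
  qed
  ultimately show ?thesis by simp
qed

text \<open>Set to zero before \<open>window\<close>, where no drift estimate is available, so that
  sums may start at 0.\<close>

definition late_deviation :: "nat \<Rightarrow> (nat \<Rightarrow> 'n \<Rightarrow> 'sig) \<Rightarrow> real" where
  "late_deviation t w = (if t \<ge> window then deviation t w else 0)"

lemma late_deviation_nonneg: "late_deviation t w \<ge> 0"
  by (simp add: late_deviation_def deviation_nonneg)

lemma adapted_late_deviation: "adapted t (late_deviation t)"
proof (cases "t \<ge> window")
  case True
  then have "late_deviation t = deviation t" by (simp add: late_deviation_def fun_eq_iff)
  then show ?thesis by (simp add: adapted_deviation)
next
  case False
  then have "late_deviation t = (\<lambda>_. 0)" by (simp add: late_deviation_def fun_eq_iff)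
  then show ?thesis by (simp add: adapted_const)
qed

lemma mean_late_deviation_nonneg: "mean (late_deviation t) \<ge> 0"
  unfolding mean_def by (intro integral_nonneg_AE AE_I2 late_deviation_nonneg)

text \<open>Telescoping: the mean potential starts at time \<open>window\<close> no lower than the
  logarithm on the right, never exceeds 0, and rises by at least the summand in each step.\<close>

lemma sum_mean_late_deviation_le:
  "gain * (\<Sum>t<T. mean (late_deviation t)) \<le> - ln ((\<delta> * lmin) ^ window * pmf (\<mu>0 j0) \<theta>s)"
proof -
  let ?\<kappa> = "(\<delta> * lmin) ^ window * pmf (\<mu>0 j0) \<theta>s"
  have \<kappa>: "0 < ?\<kappa>" using \<delta>_pos lmin(1) prior_pos by simp
  have low: "ln ?\<kappa> \<le> mean (potential window)"
  proof -
    have "mean (\<lambda>_. ln ?\<kappa>) \<le> mean (potential window)"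
    proof (rule mean_mono[where t = window])
      fix w assume w: "admissible w"
      have "ln ?\<kappa> \<le> ln (\<mu> w window \<theta>s $ i)" for i
        using belief_window_lower_bound[OF w, where t = 0 and \<theta> = \<theta>s and j = j0 and i = i] \<kappa> belief_true_pos[OF w order_refl, of i]
        by (subst ln_le_cancel_iff) auto
      then have "(\<Sum>i\<in>UNIV. abs_prob window $ i * ln ?\<kappa>) \<le> potential window w"
        unfolding potential_def by (intro sum_mono mult_left_mono abs_prob_nonneg)
      then show "ln ?\<kappa> \<le> potential window w" by (simp add: sum_distrib_right[symmetric] abs_prob_sum)
    qed (auto simp: adapted_const adapted_potential)
    then show ?thesis by (simp add: mean_const)
  qed
  have up: "mean (potential t) \<le> 0" if t: "t \<ge> window" for t
  proof -
    have "mean (potential t) \<le> mean (\<lambda>_. 0)"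
    proof (rule mean_mono[where t = t])
      fix w assume w: "admissible w"
      have "ln (\<mu> w t \<theta>s $ i) \<le> 0" for i
        using belief_true_pos[OF w t, of i] belief_le_1[OF w] by (simp add: ln_le_zero_iff)
      then show "potential t w \<le> 0"
        unfolding potential_def by (intro sum_nonpos mult_nonneg_nonpos abs_prob_nonneg)
    qed (auto simp: adapted_const adapted_potential)
    then show ?thesis by (simp add: mean_const)
  qed
  have drift: "mean (potential t) + gain * mean (late_deviation t) \<le> mean (potential (Suc t))" if t: "t \<ge> window" for t
  proof -
    have ad: "adapted t (\<lambda>w. gain * late_deviation t w)"
      by (rule adapted_compose[OF adapted_late_deviation])
    have "mean (potential t) + gain * mean (late_deviation t) = mean (\<lambda>w. potential t w + gain * late_deviation t w)"
      by (subst mean_add[OF adapted_potential ad]) (simp add: mean_mult_left)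
    also have "\<dots> \<le> mean (cexp t (potential (Suc t)))"
      by (rule mean_mono[where t = t, OF adapted_compose2[where h = "(+)", OF adapted_potential ad] adapted_cexp[OF adapted_potential]])
         (use potential_drift t in \<open>simp add: late_deviation_def\<close>)
    also have "\<dots> = mean (potential (Suc t))" by (rule mean_cexp[OF adapted_potential])
    finally show ?thesis .
  qed
  show ?thesis
  proof (cases "T \<ge> window")
    case True
    then have "gain * (\<Sum>t<T. mean (late_deviation t)) \<le> mean (potential T) - mean (potential window)"
    proof (induction T rule: dec_induct)
      case base
      have "late_deviation t = (\<lambda>_. 0)" if "t < window" for t using that by (simp add: late_deviation_def fun_eq_iff)
      then show ?case by (simp add: mean_const)
    next
      case (step T)
      then show ?case using drift[of T] by (simp add: distrib_left)
    qed
    then show ?thesis using low up[OF True] by simp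
  next
    \<comment> \<open>The sum is 0 here, and the bound on the right is non-negative because the mean
      potential at time \<open>window\<close> lies between \<open>ln ?\<kappa>\<close> and
      0.\<close>
    case False
    then have "late_deviation t = (\<lambda>_. 0)" if "t < T" for t using that by (simp add: late_deviation_def fun_eq_iff)
    then show ?thesis using low up[OF order_refl] by (simp add: mean_const)
  qed
qed

text \<open>The second limit comes from the same series shifted by one step, since
  \<open>cexp\<close> preserves means. It controls the predictions after every possible next
  signal.\<close>

lemma AE_deviation_tendsto_0:
  "AE x in M. (\<lambda>t. deviation t (path x)) \<longlonglongrightarrow> 0 \<and> (\<lambda>t. cexp t (deviation (Suc t)) (path x)) \<longlonglongrightarrow> 0"
proof -
  define K where "K = - ln ((\<delta> * lmin) ^ window * pmf (\<mu>0 j0) \<theta>s) / gain"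
  have K: "(\<Sum>t<T. mean (late_deviation t)) \<le> K" for T
    using sum_mean_late_deviation_le[of T] gain_pos by (simp add: K_def field_simps)
  have "AE x in M. (\<lambda>t. late_deviation t (path x)) \<longlonglongrightarrow> 0"
    by (rule summable_mean_AE_tendsto_0[OF adapted_late_deviation late_deviation_nonneg K])
  moreover have "AE x in M. (\<lambda>t. cexp t (late_deviation (Suc t)) (path x)) \<longlonglongrightarrow> 0"
  proof (rule summable_mean_AE_tendsto_0[where K = K])
    show "adapted t (cexp t (late_deviation (Suc t)))" for t by (rule adapted_cexp[OF adapted_late_deviation])
    show "0 \<le> cexp t (late_deviation (Suc t)) w" for t w
      unfolding cexp_def by (intro sum_nonneg mult_nonneg_nonneg late_deviation_nonneg) auto
    fix T
    have "(\<Sum>t<T. mean (cexp t (late_deviation (Suc t)))) = (\<Sum>t<T. mean (late_deviation (Suc t)))"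
      by (simp add: mean_cexp[OF adapted_late_deviation])
    also have "\<dots> \<le> (\<Sum>t<Suc T. mean (late_deviation t))"
      using mean_late_deviation_nonneg[of 0] by (subst sum.lessThan_Suc_shift) simp
    also note K
    finally show "(\<Sum>t<T. mean (cexp t (late_deviation (Suc t)))) \<le> K" .
  qed
  ultimately show ?thesis
  proof eventually_elim
    case (elim x)
    have "eventually (\<lambda>t. late_deviation t (path x) = deviation t (path x)) sequentially"
      using eventually_ge_at_top[of window] by eventually_elim (simp add: late_deviation_def)
    moreover have "eventually (\<lambda>t. cexp t (late_deviation (Suc t)) (path x) = cexp t (deviation (Suc t)) (path x)) sequentially"
      using eventually_ge_at_top[of window] by eventually_elim (simp add: late_deviation_def cexp_def)
    ultimately show ?case using elim by (simp cong: tendsto_cong)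
  qed
qed

end

section \<open>Convergence to consensus\<close>

lemma tendsto_0_of_square_bound:
  fixes f g :: "nat \<Rightarrow> real"
  assumes "\<And>t. c * (f t)\<^sup>2 \<le> g t" "c > 0" "g \<longlonglongrightarrow> 0"
  shows "f \<longlonglongrightarrow> 0"
proof -
  have "(\<lambda>t. (f t)\<^sup>2) \<longlonglongrightarrow> 0"
  proof (rule tendsto_sandwich[OF _ _ tendsto_const])
    show "eventually (\<lambda>t. (f t)\<^sup>2 \<le> g t / c) sequentially"
      using assms(1,2) by (simp add: field_simps)
    show "(\<lambda>t. g t / c) \<longlonglongrightarrow> 0" by (rule tendsto_divide_zero[OF assms(3)])
  qed auto
  then have "(\<lambda>t. sqrt ((f t)\<^sup>2)) \<longlonglongrightarrow> sqrt 0" by (rule tendsto_real_sqrt)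
  then show ?thesis by (simp add: tendsto_rabs_zero_iff)
qed

context learning
begin

section \<open>States that some agent can distinguish from the true one\<close>

text \<open>The prediction of \<open>s'\<close> that agent \<open>i\<close> would make at time
  \<open>t + 1\<close> had the signal at that time been \<open>s\<close>.\<close>

definition forecast :: "(nat \<Rightarrow> 'n \<Rightarrow> 'sig) \<Rightarrow> nat \<Rightarrow> 'n \<Rightarrow> 'sig \<Rightarrow> 'sig \<Rightarrow> real" where
  "forecast w t i s s' = (\<Sum>\<theta>\<in>UNIV. lik i s' \<theta> * bayes_step w t i \<theta> s)"

lemma predictive_tendsto:
  assumes "(\<lambda>t. deviation t w) \<longlonglongrightarrow> 0" "s \<in> S i"
  shows "(\<lambda>t. predictive w t i s) \<longlonglongrightarrow> lik i s \<theta>s"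
proof -
  have "(\<lambda>t. lik i s \<theta>s - predictive w t i s) \<longlonglongrightarrow> 0"
  proof (rule tendsto_0_of_square_bound[where c = 1])
    fix t
    have "(lik i s \<theta>s - predictive w t i s)\<^sup>2 \<le> (\<Sum>s\<in>S i. (lik i s \<theta>s - predictive w t i s)\<^sup>2)"
      using assms(2) finite_S by (intro member_le_sum) auto
    also have "\<dots> \<le> deviation t w"
      unfolding deviation_def
      by (rule member_le_sum[where f = "\<lambda>i. \<Sum>s\<in>S i. (lik i s \<theta>s - predictive w t i s)\<^sup>2"]) (auto intro: sum_nonneg)
    finally show "1 * (lik i s \<theta>s - predictive w t i s)\<^sup>2 \<le> deviation t w" by simp
  qed (use assms(1) in auto)
  from tendsto_diff[OF tendsto_const[of "lik i s \<theta>s"] this] show ?thesis by simp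
qed

text \<open>In the averaged deviation every own signal \<open>s\<close> has weight at least
  \<open>lmin\<close>, so the forecast must become correct after each of them, observed or
  not.\<close>

lemma forecast_tendsto:
  assumes "(\<lambda>t. cexp t (deviation (Suc t)) w) \<longlonglongrightarrow> 0" "s \<in> S i" "s' \<in> S i"
  shows "(\<lambda>t. forecast w t i s s') \<longlonglongrightarrow> lik i s' \<theta>s"
proof -
  have "(\<lambda>t. lik i s' \<theta>s - forecast w t i s s') \<longlonglongrightarrow> 0"
  proof (rule tendsto_0_of_square_bound[OF _ lmin(1) assms(1)])
    fix t
    let ?F = "\<lambda>i s. \<Sum>s'\<in>S i. (lik i s' \<theta>s - forecast w t i s s')\<^sup>2"
    have F: "0 \<le> ?F i s" for i s by (intro sum_nonneg) auto
    have "lmin * (lik i s' \<theta>s - forecast w t i s s')\<^sup>2 \<le> lik i s \<theta>s * ?F i s"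
      using assms(2,3) finite_S
      by (intro mult_mono lmin(3) member_le_sum[where f = "\<lambda>s'. (lik i s' \<theta>s - forecast w t i s s')\<^sup>2"] lik_nonneg) auto
    also have "\<dots> \<le> (\<Sum>s\<in>S i. lik i s \<theta>s * ?F i s)"
      using assms(2) finite_S F
      by (intro member_le_sum[where f = "\<lambda>s. lik i s \<theta>s * ?F i s"] mult_nonneg_nonneg lik_nonneg) auto
    also have "\<dots> = (\<Sum>a\<in>Pi UNIV S. pmf (l \<theta>s) a * ?F i (a i))"
      by (rule sum_marginal[symmetric])
    also have "\<dots> \<le> (\<Sum>a\<in>Pi UNIV S. pmf (l \<theta>s) a * (\<Sum>i\<in>UNIV. ?F i (a i)))"
      using F by (intro sum_mono mult_left_mono member_le_sum[where f = "\<lambda>i. ?F i (a i)" for a]) auto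
    also have "\<dots> = cexp t (deviation (Suc t)) w"
      by (simp only: cexp_def deviation_def forecast_def predictive_def belief_upd)
    finally show "lmin * (lik i s' \<theta>s - forecast w t i s s')\<^sup>2 \<le> cexp t (deviation (Suc t)) w" .
  qed
  from tendsto_diff[OF tendsto_const[of "lik i s' \<theta>s"] this] show ?thesis by simp
qed

text \<open>The difference is the covariance of the likelihoods of \<open>s\<close> and \<open>s'\<close> under the belief of agent \<open>i\<close>,
  up to a factor: the neighbours' contribution to the forecast does not depend on the signal and cancels.\<close>

lemma forecast_minus_average:
  assumes w: "admissible w" and s: "s \<in> S i"
  shows "forecast w t i s s' - (\<Sum>r\<in>S i. predictive w t i r * forecast w t i r s')
    = A t $ i $ i * ((\<Sum>\<theta>\<in>UNIV. lik i s \<theta> * lik i s' \<theta> * \<mu> w t \<theta> $ i) / predictive w t i s - predictive w t i s')"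
proof -
  let ?L = "\<lambda>r. \<Sum>\<theta>\<in>UNIV. lik i r \<theta> * lik i s' \<theta> * \<mu> w t \<theta> $ i"
  define R where "R = (\<Sum>\<theta>\<in>UNIV. lik i s' \<theta> * (\<Sum>j\<in>UNIV. A t $ i $ j * \<mu> w t \<theta> $ j))
      - A t $ i $ i * predictive w t i s'"
  have fc: "forecast w t i r s' = R + A t $ i $ i * (?L r / predictive w t i r)" for r
  proof -
    have "forecast w t i r s' = (\<Sum>\<theta>\<in>UNIV. lik i s' \<theta> * (\<Sum>j\<in>UNIV. A t $ i $ j * \<mu> w t \<theta> $ j)
        + (A t $ i $ i / predictive w t i r * (lik i r \<theta> * lik i s' \<theta> * \<mu> w t \<theta> $ i)
          - A t $ i $ i * (lik i s' \<theta> * \<mu> w t \<theta> $ i)))"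
      unfolding forecast_def bayes_step_def by (intro sum.cong refl) (simp add: algebra_simps)
    also have "\<dots> = (\<Sum>\<theta>\<in>UNIV. lik i s' \<theta> * (\<Sum>j\<in>UNIV. A t $ i $ j * \<mu> w t \<theta> $ j))
        + (A t $ i $ i / predictive w t i r * ?L r - A t $ i $ i * predictive w t i s')"
      unfolding sum.distrib sum_subtractf predictive_def[of w t i s'] by (simp only: sum_distrib_left[symmetric])
    finally show ?thesis by (simp add: R_def)
  qed
  have "(\<Sum>r\<in>S i. predictive w t i r * forecast w t i r s') = (\<Sum>r\<in>S i. predictive w t i r * R + A t $ i $ i * ?L r)"
  proof (intro sum.cong refl)
    fix r assume "r \<in> S i"
    then have "predictive w t i r \<noteq> 0" using predictive_bounds(3)[OF w, of r i t] by simp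
    then show "predictive w t i r * forecast w t i r s' = predictive w t i r * R + A t $ i $ i * ?L r"
      unfolding fc by (simp add: distrib_left)
  qed
  also have "\<dots> = (\<Sum>r\<in>S i. predictive w t i r) * R + A t $ i $ i * (\<Sum>r\<in>S i. ?L r)"
    unfolding sum.distrib sum_distrib_right[of _ _ R] sum_distrib_left[of "A t $ i $ i" ?L] by (rule refl)
  also have "(\<Sum>r\<in>S i. ?L r) = predictive w t i s'"
  proof -
    have "(\<Sum>r\<in>S i. ?L r) = (\<Sum>\<theta>\<in>UNIV. (\<Sum>r\<in>S i. lik i r \<theta>) * (lik i s' \<theta> * \<mu> w t \<theta> $ i))"
      by (subst sum.swap) (simp only: sum_distrib_right mult.assoc)
    then show ?thesis by (simp add: lik_sum predictive_def)
  qed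
  finally show ?thesis by (simp add: fc predictive_sum[OF w] right_diff_distrib)
qed

text \<open>All forecasts of \<open>s\<close> share one limit, so their difference vanishes; with
  \<open>s' = s\<close> it is a variance up to factors bounded away from 0. The likelihood thus
  concentrates at its true value, leaving no mass on \<theta>.\<close>

lemma distinguished_state_tendsto_0:
  assumes w: "admissible w"
    and dev: "(\<lambda>t. deviation t w) \<longlonglongrightarrow> 0" "(\<lambda>t. cexp t (deviation (Suc t)) w) \<longlonglongrightarrow> 0"
    and s: "s \<in> S i" and neq: "lik i s \<theta> \<noteq> lik i s \<theta>s"
  shows "(\<lambda>t. \<mu> w t \<theta> $ i) \<longlonglongrightarrow> 0"
proof -
  let ?m = "\<lambda>t. predictive w t i s"
  let ?L = "\<lambda>t. \<Sum>\<theta>\<in>UNIV. lik i s \<theta> * lik i s \<theta> * \<mu> w t \<theta> $ i"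
  let ?q = "lik i s \<theta>s"
  have m: "?m \<longlonglongrightarrow> ?q" by (rule predictive_tendsto[OF dev(1) s])
  have "(\<lambda>t. forecast w t i s s - (\<Sum>r\<in>S i. predictive w t i r * forecast w t i r s))
      \<longlonglongrightarrow> ?q - (\<Sum>r\<in>S i. lik i r \<theta>s * ?q)"
    by (intro tendsto_diff tendsto_sum tendsto_mult predictive_tendsto forecast_tendsto dev s)
  then have A: "(\<lambda>t. A t $ i $ i * (?L t / ?m t - ?m t)) \<longlonglongrightarrow> 0"
    unfolding forecast_minus_average[OF w s] by (simp add: sum_distrib_right[symmetric] lik_sum)
  have "(\<lambda>t. ?L t / ?m t - ?m t) \<longlonglongrightarrow> 0"
  proof (rule Lim_null_comparison)
    have "\<delta> * \<bar>?L t / ?m t - ?m t\<bar> \<le> \<bar>A t $ i $ i * (?L t / ?m t - ?m t)\<bar>" for t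
      unfolding abs_mult using \<delta>_le[OF diag_pos, of t i] \<delta>_pos by (intro mult_right_mono) auto
    then show "eventually (\<lambda>t. norm (?L t / ?m t - ?m t) \<le> \<bar>A t $ i $ i * (?L t / ?m t - ?m t)\<bar> / \<delta>) sequentially"
      using \<delta>_pos by (simp add: field_simps)
    show "(\<lambda>t. \<bar>A t $ i $ i * (?L t / ?m t - ?m t)\<bar> / \<delta>) \<longlonglongrightarrow> 0"
      by (rule tendsto_divide_zero[OF tendsto_rabs_zero[OF A]])
  qed
  then have "(\<lambda>t. ?m t * (?L t / ?m t - ?m t) + (?m t - ?q)\<^sup>2) \<longlonglongrightarrow> ?q * 0 + (?q - ?q)\<^sup>2"
    by (intro tendsto_intros m)
  \<comment> \<open>Variance plus squared bias is the second moment about the true likelihood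
    \<open>?q\<close>.\<close>
  moreover have "?m t * (?L t / ?m t - ?m t) + (?m t - ?q)\<^sup>2 = (\<Sum>\<theta>\<in>UNIV. (lik i s \<theta> - ?q)\<^sup>2 * \<mu> w t \<theta> $ i)" for t
  proof -
    have "(\<Sum>\<theta>\<in>UNIV. (lik i s \<theta> - ?q)\<^sup>2 * \<mu> w t \<theta> $ i)
        = (\<Sum>\<theta>\<in>UNIV. lik i s \<theta> * lik i s \<theta> * \<mu> w t \<theta> $ i - 2 * ?q * (lik i s \<theta> * \<mu> w t \<theta> $ i) + ?q\<^sup>2 * \<mu> w t \<theta> $ i)"
      by (intro sum.cong refl) (simp add: power2_eq_square algebra_simps)
    also have "\<dots> = ?L t - 2 * ?q * ?m t + ?q\<^sup>2 * (\<Sum>\<theta>\<in>UNIV. \<mu> w t \<theta> $ i)"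
      unfolding sum.distrib sum_subtractf predictive_def by (simp only: sum_distrib_left[symmetric])
    also have "\<dots> = ?m t * (?L t / ?m t - ?m t) + (?m t - ?q)\<^sup>2"
    proof -
      have "?m t \<noteq> 0" using predictive_bounds(3)[OF w s, of t] by simp
      then have "?m t * (?L t / ?m t - ?m t) = ?L t - ?m t * ?m t" by (simp add: right_diff_distrib)
      then show ?thesis by (simp add: belief_sum[OF w] power2_eq_square algebra_simps)
    qed
    finally show ?thesis by simp
  qed
  ultimately have var: "(\<lambda>t. \<Sum>\<theta>\<in>UNIV. (lik i s \<theta> - ?q)\<^sup>2 * \<mu> w t \<theta> $ i) \<longlonglongrightarrow> 0" by simp
  let ?c = "(lik i s \<theta> - ?q)\<^sup>2"
  have c: "?c > 0" using neq by simp
  show ?thesis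
  proof (rule tendsto_sandwich[OF _ _ tendsto_const])
    have "?c * \<mu> w t \<theta> $ i \<le> (\<Sum>\<theta>\<in>UNIV. (lik i s \<theta> - ?q)\<^sup>2 * \<mu> w t \<theta> $ i)" for t
      by (rule member_le_sum) (auto intro!: mult_nonneg_nonneg belief_nonneg w)
    then show "eventually (\<lambda>t. \<mu> w t \<theta> $ i \<le> (\<Sum>\<theta>\<in>UNIV. (lik i s \<theta> - ?q)\<^sup>2 * \<mu> w t \<theta> $ i) / ?c) sequentially"
      using c by (simp add: pos_le_divide_eq mult.commute)
    show "(\<lambda>t. (\<Sum>\<theta>\<in>UNIV. (lik i s \<theta> - ?q)\<^sup>2 * \<mu> w t \<theta> $ i) / ?c) \<longlonglongrightarrow> 0"
      by (rule tendsto_divide_zero[OF var])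
  qed (simp add: belief_nonneg[OF w])
qed

text \<open>One window later, the belief of \<open>i\<close> is at least a fixed multiple of the
  present belief of \<open>j\<close>.\<close>

lemma all_agents_tendsto_0:
  assumes w: "admissible w" and lim: "(\<lambda>t. \<mu> w t \<theta> $ i) \<longlonglongrightarrow> 0"
  shows "(\<lambda>t. \<mu> w t \<theta> $ j) \<longlonglongrightarrow> 0"
proof (rule tendsto_sandwich[OF _ _ tendsto_const])
  let ?c = "(\<delta> * lmin) ^ window"
  have c: "?c > 0" using \<delta>_pos lmin(1) by simp
  then show "eventually (\<lambda>t. \<mu> w t \<theta> $ j \<le> \<mu> w (t + window) \<theta> $ i / ?c) sequentially"
    using belief_window_lower_bound[OF w] by (simp add: pos_le_divide_eq mult.commute)
  show "(\<lambda>t. \<mu> w (t + window) \<theta> $ i / ?c) \<longlonglongrightarrow> 0"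
    by (rule tendsto_divide_zero[OF LIMSEQ_ignore_initial_segment[OF lim]])
qed (simp add: belief_nonneg[OF w])

section \<open>States that nobody can distinguish from the true one\<close>

text \<open>As the likelihoods of \<theta> equal the true ones, the expected Bayesian correction is
  a non-negative multiple of a chi-square divergence; the averaging part is preserved by the
  absolute probabilities.\<close>

lemma average_belief_submartingale:
  assumes w: "admissible w" and equiv: "\<And>i s. s \<in> S i \<Longrightarrow> lik i s \<theta> = lik i s \<theta>s"
  shows "(\<Sum>i\<in>UNIV. abs_prob t $ i * \<mu> w t \<theta> $ i)
    \<le> cexp t (\<lambda>w. \<Sum>i\<in>UNIV. abs_prob (Suc t) $ i * \<mu> w (Suc t) \<theta> $ i) w"
proof -
  let ?Q = "\<lambda>i. \<Sum>j\<in>UNIV. A t $ i $ j * \<mu> w t \<theta> $ j"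
  have drift: "(\<Sum>a\<in>Pi UNIV S. pmf (l \<theta>s) a * bayes_step w t i \<theta> (a i)) \<ge> ?Q i" for i
  proof -
    let ?k = "A t $ i $ i * \<mu> w t \<theta> $ i"
    have "(\<Sum>a\<in>Pi UNIV S. pmf (l \<theta>s) a * bayes_step w t i \<theta> (a i))
        = (\<Sum>s\<in>S i. lik i s \<theta>s * ?Q i + ?k * (lik i s \<theta>s * (lik i s \<theta>s / predictive w t i s - 1)))"
      unfolding sum_marginal[where g = "bayes_step w t i \<theta>"]
      by (intro sum.cong refl) (simp add: bayes_step_def equiv algebra_simps)
    also have "\<dots> = (\<Sum>s\<in>S i. lik i s \<theta>s) * ?Q i + ?k * (\<Sum>s\<in>S i. lik i s \<theta>s * (lik i s \<theta>s / predictive w t i s - 1))"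
      by (simp only: sum.distrib sum_distrib_right[of _ _ "?Q i"] sum_distrib_left[of ?k])
    also have "\<dots> \<ge> ?Q i"
    proof -
      have "0 \<le> (\<Sum>s\<in>S i. lik i s \<theta>s * (lik i s \<theta>s / predictive w t i s - 1))"
        by (rule chi_square_nonneg) (auto simp: predictive_bounds[OF w] lik_sum predictive_sum[OF w])
      then have "0 \<le> ?k * (\<Sum>s\<in>S i. lik i s \<theta>s * (lik i s \<theta>s / predictive w t i s - 1))"
        by (intro mult_nonneg_nonneg A_nonneg belief_nonneg w)
      then show ?thesis by (simp add: lik_sum)
    qed
    finally show ?thesis .
  qed
  have "(\<Sum>i\<in>UNIV. abs_prob t $ i * \<mu> w t \<theta> $ i) = (\<Sum>i\<in>UNIV. abs_prob (Suc t) $ i * ?Q i)"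
    by (rule abs_prob_average[symmetric])
  also have "\<dots> \<le> (\<Sum>i\<in>UNIV. abs_prob (Suc t) $ i * (\<Sum>a\<in>Pi UNIV S. pmf (l \<theta>s) a * bayes_step w t i \<theta> (a i)))"
    by (intro sum_mono mult_left_mono drift abs_prob_nonneg)
  also have "\<dots> = cexp t (\<lambda>w. \<Sum>i\<in>UNIV. abs_prob (Suc t) $ i * \<mu> w (Suc t) \<theta> $ i) w"
    unfolding cexp_def belief_upd sum_distrib_left by (subst sum.swap) (simp add: mult.left_commute)
  finally show ?thesis .
qed

lemma AE_average_belief_convergent:
  assumes "\<And>i s. s \<in> S i \<Longrightarrow> lik i s \<theta> = lik i s \<theta>s"
  shows "AE x in M. convergent (\<lambda>t. \<Sum>i\<in>UNIV. abs_prob t $ i * \<mu> (path x) t \<theta> $ i)"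
proof (rule bounded_submartingale_convergent[where Y = "\<lambda>t w. \<Sum>i\<in>UNIV. abs_prob t $ i * \<mu> w t \<theta> $ i"])
  show "adapted t (\<lambda>w. \<Sum>i\<in>UNIV. abs_prob t $ i * \<mu> w t \<theta> $ i)" for t
    by (rule adapted_compose[where h = "\<lambda>b. \<Sum>i\<in>UNIV. abs_prob t $ i * b \<theta> $ i", OF adapted_belief])
  fix t w assume w: "admissible w"
  have "(\<Sum>i\<in>UNIV. abs_prob t $ i * \<mu> w t \<theta> $ i) \<le> (\<Sum>i\<in>UNIV. abs_prob t $ i * 1)"
    by (intro sum_mono mult_left_mono abs_prob_nonneg belief_le_1 w)
  then show "0 \<le> (\<Sum>i\<in>UNIV. abs_prob t $ i * \<mu> w t \<theta> $ i) \<and> (\<Sum>i\<in>UNIV. abs_prob t $ i * \<mu> w t \<theta> $ i) \<le> 1"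
    using sum_nonneg[of UNIV "\<lambda>i. abs_prob t $ i * \<mu> w t \<theta> $ i"] abs_prob_nonneg belief_nonneg[OF w]
    by (simp add: abs_prob_sum)
  show "(\<Sum>i\<in>UNIV. abs_prob t $ i * \<mu> w t \<theta> $ i)
    \<le> cexp t (\<lambda>w. \<Sum>i\<in>UNIV. abs_prob (Suc t) $ i * \<mu> w (Suc t) \<theta> $ i) w"
    by (rule average_belief_submartingale[OF w assms])
qed

text \<open>The observed signal changes with \<open>t\<close>, so the likelihood ratio is compared
  with 1 through a sum over all signals of the agent.\<close>

lemma innovation_tendsto_0:
  assumes w: "admissible w" and equiv: "\<And>i s. s \<in> S i \<Longrightarrow> lik i s \<theta> = lik i s \<theta>s"
    and dev: "(\<lambda>t. deviation t w) \<longlonglongrightarrow> 0"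
  shows "(\<lambda>t. \<mu> w (Suc t) \<theta> - A t *v \<mu> w t \<theta>) \<longlonglongrightarrow> 0"
proof (rule vec_tendstoI)
  fix i
  let ?s = "\<lambda>t. w (Suc t) i"
  have s: "?s t \<in> S i" for t using w by (auto simp: admissible_def)
  have "(\<lambda>t. \<Sum>s\<in>S i. \<bar>lik i s \<theta>s - predictive w t i s\<bar>) \<longlonglongrightarrow> (\<Sum>s\<in>S i. \<bar>lik i s \<theta>s - lik i s \<theta>s\<bar>)"
    by (intro tendsto_intros predictive_tendsto dev)
  then have lim: "(\<lambda>t. (\<Sum>s\<in>S i. \<bar>lik i s \<theta>s - predictive w t i s\<bar>) / lmin) \<longlonglongrightarrow> 0"
    by (intro tendsto_divide_zero) simp
  have bound: "\<bar>A t $ i $ i * \<mu> w t \<theta> $ i * (lik i (?s t) \<theta> / predictive w t i (?s t) - 1)\<bar>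
      \<le> (\<Sum>s\<in>S i. \<bar>lik i s \<theta>s - predictive w t i s\<bar>) / lmin" for t
  proof -
    have pr: "lmin \<le> predictive w t i (?s t)" "0 < predictive w t i (?s t)"
      using predictive_bounds[OF w s] by auto
    have "A t $ i $ i \<le> 1"
      using member_le_sum[of i UNIV "\<lambda>j. A t $ i $ j"] A_row_sum[of t i] A_nonneg by auto
    then have "A t $ i $ i * \<mu> w t \<theta> $ i \<le> 1 * 1"
      by (intro mult_mono A_nonneg belief_le_1 belief_nonneg w) auto
    then have k: "\<bar>A t $ i $ i * \<mu> w t \<theta> $ i\<bar> \<le> 1"
      using A_nonneg[of t i i] belief_nonneg[OF w, of t \<theta> i] by simp
    have "\<bar>A t $ i $ i * \<mu> w t \<theta> $ i * (lik i (?s t) \<theta> / predictive w t i (?s t) - 1)\<bar>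
        \<le> 1 * \<bar>lik i (?s t) \<theta> / predictive w t i (?s t) - 1\<bar>"
      unfolding abs_mult[of "A t $ i $ i * \<mu> w t \<theta> $ i"] by (intro mult_right_mono k) auto
    also have "\<dots> = \<bar>lik i (?s t) \<theta>s - predictive w t i (?s t)\<bar> / predictive w t i (?s t)"
      using pr by (simp add: equiv[OF s] diff_divide_distrib[symmetric] divide_diff_eq_iff abs_divide)
    also have "\<dots> \<le> \<bar>lik i (?s t) \<theta>s - predictive w t i (?s t)\<bar> / lmin"
      using pr lmin(1) by (intro divide_left_mono) auto
    also have "\<dots> \<le> (\<Sum>s\<in>S i. \<bar>lik i s \<theta>s - predictive w t i s\<bar>) / lmin"
      using lmin(1) s finite_S
      by (intro divide_right_mono member_le_sum[where f = "\<lambda>s. \<bar>lik i s \<theta>s - predictive w t i s\<bar>"]) auto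
    finally show ?thesis .
  qed
  have eq: "(\<mu> w (Suc t) \<theta> - A t *v \<mu> w t \<theta>) $ i
      = A t $ i $ i * \<mu> w t \<theta> $ i * (lik i (?s t) \<theta> / predictive w t i (?s t) - 1)" for t
    unfolding vector_minus_component belief_Suc bayes_step_def by (simp add: matrix_vector_mult_def)
  show "(\<lambda>t. (\<mu> w (Suc t) \<theta> - A t *v \<mu> w t \<theta>) $ i) \<longlonglongrightarrow> 0 $ i"
    unfolding eq zero_index by (rule Lim_null_comparison[OF _ lim]) (simp add: bound)
qed

text \<open>A weighted average of the beliefs differs from each of them by at most the gap, which
  tends to 0 because the correction does.\<close>

lemma equivalent_state_consensus:
  assumes w: "admissible w" and equiv: "\<And>i s. s \<in> S i \<Longrightarrow> lik i s \<theta> = lik i s \<theta>s"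
    and dev: "(\<lambda>t. deviation t w) \<longlonglongrightarrow> 0"
    and conv: "(\<lambda>t. \<Sum>i\<in>UNIV. abs_prob t $ i * \<mu> w t \<theta> $ i) \<longlonglongrightarrow> c"
  shows "(\<lambda>t. \<mu> w t \<theta> $ i) \<longlonglongrightarrow> c"
proof -
  have gap: "(\<lambda>t. gap (\<mu> w t \<theta>)) \<longlonglongrightarrow> 0"
    by (rule perturbed_consensus[where s = 0 and K = 1, OF _ innovation_tendsto_0[OF w equiv dev]])
       (use belief_nonneg[OF w] belief_le_1[OF w] in \<open>auto simp del: belief.simps\<close>)
  have "(\<lambda>t. \<mu> w t \<theta> $ i - (\<Sum>j\<in>UNIV. abs_prob t $ j * \<mu> w t \<theta> $ j)) \<longlonglongrightarrow> 0"
  proof (rule Lim_null_comparison[OF always_eventually[OF allI] gap])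
    fix t
    have "\<mu> w t \<theta> $ i - (\<Sum>j\<in>UNIV. abs_prob t $ j * \<mu> w t \<theta> $ j)
        = (\<Sum>j\<in>UNIV. abs_prob t $ j * (\<mu> w t \<theta> $ i - \<mu> w t \<theta> $ j))"
      by (simp add: right_diff_distrib sum_subtractf sum_distrib_right[symmetric] abs_prob_sum)
    also have "norm \<dots> \<le> (\<Sum>j\<in>UNIV. abs_prob t $ j * gap (\<mu> w t \<theta>))"
    proof (rule sum_norm_le)
      fix j
      have "\<bar>\<mu> w t \<theta> $ i - \<mu> w t \<theta> $ j\<bar> \<le> gap (\<mu> w t \<theta>)"
        using diff_le_gap[of "\<mu> w t \<theta>" i j] diff_le_gap[of "\<mu> w t \<theta>" j i] by (simp add: abs_le_iff)
      then show "norm (abs_prob t $ j * (\<mu> w t \<theta> $ i - \<mu> w t \<theta> $ j)) \<le> abs_prob t $ j * gap (\<mu> w t \<theta>)"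
        using abs_prob_nonneg[of t j] by (simp add: abs_mult mult_left_mono)
    qed
    also have "\<dots> = gap (\<mu> w t \<theta>)" by (simp add: sum_distrib_right[symmetric] abs_prob_sum)
    finally show "norm (\<mu> w t \<theta> $ i - (\<Sum>j\<in>UNIV. abs_prob t $ j * \<mu> w t \<theta> $ j)) \<le> gap (\<mu> w t \<theta>)" .
  qed
  from tendsto_add[OF this conv] show ?thesis by simp
qed

section \<open>Almost sure consensus\<close>

lemma AE_consensus: "AE x in M. \<exists>c. \<forall>i. (\<lambda>t. \<mu> (path x) t \<theta> $ i) \<longlonglongrightarrow> c"
proof (cases "\<forall>i. \<forall>s\<in>S i. lik i s \<theta> = lik i s \<theta>s")
  case True
  then have equiv: "\<And>i s. s \<in> S i \<Longrightarrow> lik i s \<theta> = lik i s \<theta>s" by blast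
  have "AE x in M. convergent (\<lambda>t. \<Sum>i\<in>UNIV. abs_prob t $ i * \<mu> (path x) t \<theta> $ i)"
    by (rule AE_average_belief_convergent) (rule equiv)
  moreover have "AE x in M. x \<in> space M" by simp
  ultimately show ?thesis using AE_deviation_tendsto_0
  proof eventually_elim
    case (elim x)
    then obtain c where "(\<lambda>t. \<Sum>i\<in>UNIV. abs_prob t $ i * \<mu> (path x) t \<theta> $ i) \<longlonglongrightarrow> c"
      by (auto simp: convergent_def)
    then show ?case
      using equivalent_state_consensus[OF admissible_path equiv] elim by blast
  qed
next
  case False
  then obtain i s where s: "s \<in> S i" "lik i s \<theta> \<noteq> lik i s \<theta>s" by blast
  have "AE x in M. x \<in> space M" by simp
  with AE_deviation_tendsto_0 show ?thesis
  proof eventually_elim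
    case (elim x)
    then have "(\<lambda>t. \<mu> (path x) t \<theta> $ i) \<longlonglongrightarrow> 0"
      by (intro distinguished_state_tendsto_0[OF admissible_path _ _ s]) auto
    then show ?case using all_agents_tendsto_0[OF admissible_path] elim by blast
  qed
qed

lemma consensus_random_variable:
  "\<exists>C \<in> borel_measurable M. (\<forall>x\<in>space M. C x \<in> {0..1::real}) \<and>
     (AE x in M. (\<lambda>t. \<mu> (\<lambda>t. \<omega> t x) t \<theta>) \<longlonglongrightarrow> C x *\<^sub>R 1)"
proof -
  \<comment> \<open>Clamping keeps the values in the unit interval on the exceptional null set as
    well; elsewhere the limit already lies there, and by consensus it is that of every
    agent.\<close>
  define C where "C x = max 0 (min 1 (lim (\<lambda>t. \<mu> (path x) t \<theta> $ j0)))" for x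
  have "(\<lambda>x. \<mu> (path x) t \<theta> $ j0) \<in> borel_measurable M" for t
    by (rule adapted_measurable[of t "\<lambda>w. \<mu> w t \<theta> $ j0"],
        rule adapted_compose[where h = "\<lambda>b. b \<theta> $ j0", OF adapted_belief])
  then have "C \<in> borel_measurable M"
    unfolding C_def by (intro borel_measurable_max borel_measurable_min borel_measurable_lim_metric) auto
  moreover have "AE x in M. (\<lambda>t. \<mu> (\<lambda>t. \<omega> t x) t \<theta>) \<longlonglongrightarrow> C x *\<^sub>R 1"
  proof -
    have "AE x in M. x \<in> space M" by simp
    with AE_consensus[of \<theta>] show ?thesis
    proof eventually_elim
      case (elim x)
      then obtain c where c: "\<And>i. (\<lambda>t. \<mu> (path x) t \<theta> $ i) \<longlonglongrightarrow> c" by blast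
      note w = admissible_path[OF elim(2)]
      have "0 \<le> c" by (rule LIMSEQ_le_const[OF c[of j0]]) (use belief_nonneg[OF w] in blast)
      moreover have "c \<le> 1" by (rule LIMSEQ_le_const2[OF c[of j0]]) (use belief_le_1[OF w] in blast)
      ultimately have "C x = c" by (simp add: C_def limI[OF c])
      then have "(\<lambda>t. \<mu> (path x) t \<theta>) \<longlonglongrightarrow> C x *\<^sub>R 1"
        by (intro vec_tendstoI) (simp add: c)
      then show ?case by (simp only: path_def)
    qed
  qed
  ultimately show ?thesis by (intro bexI[of _ C]) (auto simp: C_def)
qed

end

theorem theorem2:
  fixes M :: "'w measure"
    and S :: "'n::finite \<Rightarrow> 'sig set"
    and l :: "'state::finite \<Rightarrow> ('n \<Rightarrow> 'sig) pmf"
    and \<theta>s :: 'state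
    and \<omega> :: "nat \<Rightarrow> 'w \<Rightarrow> 'n \<Rightarrow> 'sig"
    and A :: "nat \<Rightarrow> real^'n^'n"
    and \<mu>0 :: "'n \<Rightarrow> 'state pmf"
    and j0 :: 'n
  assumes "prob_space M"
    and "\<And>i. finite (S i)"
    and "\<And>\<theta>. set_pmf (l \<theta>) \<subseteq> (\<Pi> i\<in>UNIV. S i)"
    and "\<And>i s \<theta>. s \<in> S i \<Longrightarrow> marginal_likelihood l i s \<theta> > 0"
    and "\<And>t x. t \<ge> 1 \<Longrightarrow> x \<in> space M \<Longrightarrow> \<omega> t x \<in> (\<Pi> i\<in>UNIV. S i)"
    and "prob_space.indep_vars M (\<lambda>_. count_space UNIV) \<omega> {1..}"
    and "\<And>t. t \<ge> 1 \<Longrightarrow> distr M (count_space UNIV) (\<omega> t) = measure_pmf (l \<theta>s)"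
    and "\<And>t. stochastic_matrix (A t)"
    and "pmf (\<mu>0 j0) \<theta>s > 0"
    and "uniformly_strongly_connected A"
  shows "\<forall>\<theta>. \<exists>C \<in> borel_measurable M. (\<forall>x\<in>space M. C x \<in> {0..1::real}) \<and>
           (AE x in M. (\<lambda>t. belief A l \<mu>0 (\<lambda>t. \<omega> t x) t \<theta>) \<longlonglongrightarrow> C x *\<^sub>R 1)"
proof -
  from assms(10) obtain \<delta> B where \<delta>: "\<delta> > 0" "\<And>i j t. A t $ i $ j \<ge> \<delta> \<or> A t $ i $ j = 0"
    and diag: "\<And>i t. A t $ i $ i > 0"
    and B: "B \<ge> 1" "\<And>k. strongly_connected
        (with_proj \<lparr> pverts = UNIV,
                     parcs = (\<Union>q\<in>{k * B..<(k + 1) * B}. influence_edges (A q)) \<rparr>)"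
    unfolding uniformly_strongly_connected_def by blast
  interpret prob_space M by fact
  have fin: "finite (Pi UNIV S)"
    using finite_PiE[of UNIV S] assms(2) by (simp add: PiE_UNIV_domain)
  have \<delta>_le: "A t $ i $ j \<ge> \<delta>" if "A t $ i $ j > 0" for t i j
    using \<delta>(2)[of t i j] that by auto
  interpret learning A \<delta> B M \<omega> l \<theta>s S \<mu>0 j0
    by unfold_locales (fact assms fin \<delta>(1) \<delta>_le diag B)+
  show ?thesis using consensus_random_variable by blast
qed

end
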